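(* Let $\Omega=\{(x,y)\in\mathbb{R}\times\mathbb{R}: x\neq y\}$ and let $K$ be a continuous function on $\Omega$ for which there exist constants $C_K>0$ and $0<\delta<1$ such that $$|K(x,y)|\le \frac{C_K}{|x-y|}\qquad \text{for all }(x,y)\in\Omega,$$ and, for all $x,x_0,y\in\mathbb{R}$ with $|x-y|>2|x-x_0|$, $$|K(x,y)-K(x_0,y)|+|K(y,x)-K(y,x_0)|\le \frac{C_K}{|x-y|}\left(\frac{|x-x_0|}{|x-y|}\right)^{\delta}.$$ Let $\rho>2$, let $m$ be a positive integer, let $0<\beta<1$, and let $b$ be a function on $\mathbb{R}$ whose $m$-th derivative satisfies $b^{(m)}\in\dot{\Lambda}_\beta(\mathbb{R})$. Let $T=\{T_\epsilon\}_{\epsilon>0}$ and $T^b=\{T^b_\epsilon\}_{\epsilon>0}$ be the families of operators $$T_\epsilon f(x)=\int_{|x-y|>\epsilon}K(x,y)f(y)\,dy,\qquad T^b_\epsilon f(x)=\int_{|x-y|>\epsilon}\frac{R_{m+1}(b;x,y)}{|x-y|^m}K(x,y)f(y)\,dy .$$ Fix a decreasing sequence $\{t_i\}_{i\ge1}$ of positive numbers converging to $0$, and let $\mathcal{O}$ and $\mathcal{V}_\rho$ denote the associated oscillation operator and the $\rho$-variation operator. Suppose that $\mathcal{O}(T)$ and $\mathcal{V}_\rho(T)$ are bounded on $L_{p_0}(\mathbb{R},dx)$ for some $1<p_0<\infty$. Then for any $1<p<\frac1\beta$, $\frac1q=\frac1p-\beta$, $0<\kappa<\frac pq$ and $w\in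 A_{p,q}$, the operators $\mathcal{O}(T^b)$ and $\mathcal{V}_\rho(T^b)$ are bounded from $L_{p,\kappa}(w^p,w^q)$ to $L_{q,\frac{\kappa q}{p}}(w^q)$; that is, there is a constant $C>0$ independent of $f$ such that for all $f\in L_{p,\kappa}(w^p,w^q)$, $$\|\mathcal{O}(T^bf)\|_{L_{q,\kappa q/p}(w^q)}\le C\|f\|_{L_{p,\kappa}(w^p,w^q)}\quad\text{and}\quad \|\mathcal{V}_\rho(T^bf)\|_{L_{q,\kappa q/p}(w^q)}\le C\|f\|_{L_{p,\kappa}(w^p,w^q)} .$$
   Context: **Taylor remainder.** For a function $b$ on $\mathbb{R}$ and a positive integer $m$, $R_{m+1}(b;x,y)=b(x)-\sum_{\gamma=0}^{m}\frac{1}{\gamma!}b^{(\gamma)}(y)(x-y)^\gamma$. **Oscillation and variation.** For a family of operators $S=\{S_\epsilon\}_{\epsilon>0}$ (here $S=T$ or $S=T^b$) and a fixed decreasing sequence $\{t_i\}_{i\ge 1}$ of positive numbers converging to $0$, $$\mathcal{O}(Sf)(x)=\left(\sum_{i=1}^\infty\ \sup_{t_{i+1}\le\epsilon_{i+1}<\epsilon_i\le t_i}|S_{\epsilon_{i+1}}f(x)-S_{\epsilon_i}f(x)|^2\right)^{1/2},$$ $$\mathcal{V}_\rho(Sf)(x)=\sup_{\epsilon_i\searrow0}\left(\sum_{i=1}^\infty|S_{\epsilon_{i+1}}f(x)-S_{\epsilon_i}f(x)|^\rho\right)^{1/\rho},$$ where the last supremum is over all sequences $\{\epsilon_i\}$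 of positive real numbers decreasing to $0$. $\mathcal{O}(S)$ and $\mathcal{V}_\rho(S)$ denote the operators $f\mapsto\mathcal{O}(Sf)$ and $f\mapsto\mathcal{V}_\rho(Sf)$. Boundedness of such an operator between two (semi)normed function spaces means that the norm of the output is at most a constant, independent of $f$, times the norm of $f$. **Homogeneous Lipschitz space.** For $0<\beta\le1$, $\dot\Lambda_\beta(\mathbb{R})$ is the set of functions $g$ with $\|g\|_{\dot\Lambda_\beta}=\sup_{x,h\in\mathbb{R},\,h\ne0}\frac{|g(x+h)-g(x)|}{|h|^\beta}<\infty$. **Weights.** A weight is a nonnegative locally integrable function on $\mathbb{R}$; $I$ always denotes a bounded interval in $\mathbb{R}$, $|I|$ its Lebesgue measure, and $v(I)=\int_Iv(x)\,dx$ for a weight $v$; in particular $w^q(I)=\int_I w(x)^q\,dx$. For $1<p<q<\infty$ and $p'=\frac{p}{p-1}$, $w\in A_{p,q}$ means $$\sup_I\left(\frac1{|I|}\int_Iw(x)^q\,dx\right)^{1/q}\left(\frac1{|I|}\int_Iw(x)^{-p'}\,dx\right)^{1/p'}<\infty .$$ **Weighted Morrey spaces.** For $1\le p<\infty$, $0<\kappa<1$ and weights $u,v$, $L_{p,\kappa}(u,v)$ is the space of functions $f\in L^{loc}_{p,u}(\mathbb{R})$ (i.e. $|f|^pu$ is locally integrable) with $$\|f\|_{L_{p,\kappa}(u,v)}=\sup_I v(I)^{-\kappa/p}\left(\int_I|f(x)|^pu(x)\,dx\right)^{1/p}<\infty ,$$ the supremum being over all bounded intervals $I\subset\mathbb{R}$.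 One writes $L_{p,\kappa}(w)=L_{p,\kappa}(w,w)$. Thus $\|g\|_{L_{q,\kappa q/p}(w^q)}=\sup_I w^q(I)^{-\kappa/p}\left(\int_I|g(x)|^qw(x)^q\,dx\right)^{1/q}$. *)

theory Defs
  imports "HOL-Analysis.Analysis"
begin

text \<open>
  Kernels, symbols and functions on the line are complex valued, which contains the real valued
  case. Oscillation, variation and all norms take values in \<open>[0, \<infinity>]\<close>, so that suprema and series
  need no convergence side conditions. Measurability and integrals refer to Lebesgue measure.
\<close>

text \<open>
  Real powers on \<open>[0, \<infinity>]\<close>. Unlike for \<open>powr\<close> on the reals, negative powers of \<open>0\<close> are \<open>\<infinity>\<close>;
  this matters for \<open>w\<^sup>-\<^sup>p\<^sup>'\<close> in the \<open>A\<^sub>p\<^sub>,\<^sub>q\<close> condition.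
\<close>

definition epowr :: "ennreal \<Rightarrow> real \<Rightarrow> ennreal" where
  "epowr x r =
     (if r = 0 then 1
      else if x = 0 then (if 0 < r then 0 else \<infinity>)
      else if x = \<infinity> then (if 0 < r then \<infinity> else 0)
      else ennreal (enn2real x powr r))"

subsection \<open>Derivatives of functions of a real variable and the Taylor remainder\<close>

definition nderiv :: "nat \<Rightarrow> (real \<Rightarrow> complex) \<Rightarrow> real \<Rightarrow> complex" where
  "nderiv k b = ((\<lambda>g x. vector_derivative g (at x)) ^^ k) b"

definition times_differentiable :: "nat \<Rightarrow> (real \<Rightarrow> complex) \<Rightarrow> bool" where
  "times_differentiable m b \<longleftrightarrow> (\<forall>k<m. \<forall>x. nderiv k b differentiable (at x))"

text \<open>\<open>taylor_rem m b x y\<close> is \<open>R\<^sub>m\<^sub>+\<^sub>1(b; x, y)\<close>.\<close>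

definition taylor_rem :: "nat \<Rightarrow> (real \<Rightarrow> complex) \<Rightarrow> real \<Rightarrow> real \<Rightarrow> complex" where
  "taylor_rem m b x y =
     b x - (\<Sum>k\<le>m. complex_of_real (1 / fact k) * nderiv k b y * complex_of_real ((x - y) ^ k))"

definition lipschitz_space :: "real \<Rightarrow> (real \<Rightarrow> complex) set" where
  "lipschitz_space \<beta> =
     {g. bdd_above {norm (g (x + h) - g x) / \<bar>h\<bar> powr \<beta> | x h. h \<noteq> 0}}"

subsection \<open>Truncated operators, oscillation and variation\<close>

definition sing_int ::
  "(real \<Rightarrow> real \<Rightarrow> complex) \<Rightarrow> real \<Rightarrow> (real \<Rightarrow> complex) \<Rightarrow> real \<Rightarrow> complex" where
  "sing_int K \<epsilon> f x = (LINT y:{y. \<bar>x - y\<bar> > \<epsilon>}|lebesgue. K x y * f y)"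

definition sing_comm ::
  "nat \<Rightarrow> (real \<Rightarrow> complex) \<Rightarrow> (real \<Rightarrow> real \<Rightarrow> complex) \<Rightarrow>
   real \<Rightarrow> (real \<Rightarrow> complex) \<Rightarrow> real \<Rightarrow> complex" where
  "sing_comm m b K \<epsilon> f x =
     (LINT y:{y. \<bar>x - y\<bar> > \<epsilon>}|lebesgue.
        taylor_rem m b x y / complex_of_real (\<bar>x - y\<bar> ^ m) * K x y * f y)"

text \<open>The sequences \<open>t\<close> and \<open>e\<close> are indexed from \<open>0\<close> instead of \<open>1\<close>.\<close>

definition oscillation ::
  "(nat \<Rightarrow> real) \<Rightarrow> (real \<Rightarrow> (real \<Rightarrow> complex) \<Rightarrow> real \<Rightarrow> complex) \<Rightarrow>
   (real \<Rightarrow> complex) \<Rightarrow> real \<Rightarrow> ennreal" where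
  "oscillation t S f x =
     epowr (\<Sum>i. SUP (\<delta>, \<epsilon>) \<in> {(\<delta>, \<epsilon>). t (Suc i) \<le> \<delta> \<and> \<delta> < \<epsilon> \<and> \<epsilon> \<le> t i}.
              ennreal ((norm (S \<delta> f x - S \<epsilon> f x))\<^sup>2)) (1 / 2)"

definition variation ::
  "real \<Rightarrow> (real \<Rightarrow> (real \<Rightarrow> complex) \<Rightarrow> real \<Rightarrow> complex) \<Rightarrow>
   (real \<Rightarrow> complex) \<Rightarrow> real \<Rightarrow> ennreal" where
  "variation \<rho> S f x =
     (SUP e \<in> {e :: nat \<Rightarrow> real. decseq e \<and> (\<forall>i. 0 < e i) \<and> e \<longlonglongrightarrow> 0}.
        epowr (\<Sum>i. ennreal (norm (S (e (Suc i)) f x - S (e i) f x) powr \<rho>)) (1 / \<rho>))"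

subsection \<open>Weights\<close>

text \<open>
  Integrals over a bounded interval do not see its endpoints, and an interval of length zero
  carries no information; so suprema over bounded intervals range over \<open>{a..b}\<close> with \<open>a < b\<close>.
\<close>

definition weight :: "(real \<Rightarrow> real) \<Rightarrow> bool" where
  "weight w \<longleftrightarrow> (\<forall>x. 0 \<le> w x) \<and> (\<forall>a b. set_integrable lebesgue {a..b} w)"

text \<open>
  Finiteness of the second integral is required separately because \<open>0 * \<infinity> = 0\<close> in \<^typ>\<open>ennreal\<close>.
  The only weights it excludes are those vanishing almost everywhere: if \<open>w\<close> vanishes on a set of
  positive measure but not almost everywhere, then the product is \<open>\<infinity>\<close> on large intervals.
\<close>

definition A_weight :: "real \<Rightarrow> real \<Rightarrow> (real \<Rightarrow> real) \<Rightarrow> bool" where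
  "A_weight p q w \<longleftrightarrow>
     (let p' = p / (p - 1) in
        weight w \<and>
        (\<forall>a b. (\<integral>\<^sup>+x\<in>{a..b}. epowr (ennreal (w x)) (- p') \<partial>lebesgue) < \<infinity>) \<and>
        (SUP (a, b) \<in> {(a, b). a < b}.
           epowr ((\<integral>\<^sup>+x\<in>{a..b}. ennreal (w x powr q) \<partial>lebesgue) / ennreal (b - a)) (1 / q) *
           epowr ((\<integral>\<^sup>+x\<in>{a..b}. epowr (ennreal (w x)) (- p') \<partial>lebesgue) / ennreal (b - a))
             (1 / p')) < \<infinity>)"

subsection \<open>Function spaces and boundedness\<close>

text \<open>
  The spaces below depend on a function only through its absolute value. They are therefore
  given as sets of functions into \<open>[0, \<infinity>]\<close>, together with their norms.
\<close>

definition Lp_norm :: "real \<Rightarrow> (real \<Rightarrow> ennreal) \<Rightarrow> ennreal" where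
  "Lp_norm p g = epowr (\<integral>\<^sup>+x. epowr (g x) p \<partial>lebesgue) (1 / p)"

definition Lp_space :: "real \<Rightarrow> (real \<Rightarrow> ennreal) set" where
  "Lp_space p = {g \<in> borel_measurable lebesgue. Lp_norm p g < \<infinity>}"

definition morrey_norm ::
  "real \<Rightarrow> real \<Rightarrow> (real \<Rightarrow> real) \<Rightarrow> (real \<Rightarrow> real) \<Rightarrow> (real \<Rightarrow> ennreal) \<Rightarrow> ennreal" where
  "morrey_norm p \<kappa> u v g =
     (SUP (a, b) \<in> {(a, b). a < b}.
        epowr (\<integral>\<^sup>+x\<in>{a..b}. ennreal (v x) \<partial>lebesgue) (- \<kappa> / p) *
        epowr (\<integral>\<^sup>+x\<in>{a..b}. epowr (g x) p * ennreal (u x) \<partial>lebesgue) (1 / p))"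

definition morrey_space ::
  "real \<Rightarrow> real \<Rightarrow> (real \<Rightarrow> real) \<Rightarrow> (real \<Rightarrow> real) \<Rightarrow> (real \<Rightarrow> ennreal) set" where
  "morrey_space p \<kappa> u v =
     {g \<in> borel_measurable lebesgue.
        (\<forall>a b. (\<integral>\<^sup>+x\<in>{a..b}. epowr (g x) p * ennreal (u x) \<partial>lebesgue) < \<infinity>) \<and>
        morrey_norm p \<kappa> u v g < \<infinity>}"

definition bounded_operator ::
  "((real \<Rightarrow> complex) \<Rightarrow> real \<Rightarrow> ennreal) \<Rightarrow>
   (real \<Rightarrow> ennreal) set \<Rightarrow> ((real \<Rightarrow> ennreal) \<Rightarrow> ennreal) \<Rightarrow>
   (real \<Rightarrow> ennreal) set \<Rightarrow> ((real \<Rightarrow> ennreal) \<Rightarrow> ennreal) \<Rightarrow> bool" where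
  "bounded_operator U X norm_X Y norm_Y \<longleftrightarrow>
     (\<exists>C>0. \<forall>f \<in> borel_measurable lebesgue.
        (\<lambda>x. ennreal (norm (f x))) \<in> X \<longrightarrow>
        U f \<in> Y \<and> norm_Y (U f) \<le> ennreal C * norm_X (\<lambda>x. ennreal (norm (f x))))"

end

theory Submission
  imports Defs
begin

text \<open>
  The Taylor remainder is \<open>O(\<bar>x - y\<bar>\<^sup>m\<^sup>+\<^sup>\<beta>)\<close>, so the kernel of \<open>T\<^sup>b\<close> is \<open>O(\<bar>x - y\<bar>\<^sup>\<beta>\<^sup>-\<^sup>1)\<close>. As \<open>\<ell>\<^sup>1\<close> norms
  dominate \<open>\<ell>\<^sup>2\<close> and \<open>\<ell>\<^sup>\<rho>\<close> norms, oscillation and variation of \<open>T\<^sup>b f\<close> are at most a multiple of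
  the fractional integral of \<open>\<bar>f\<bar>\<close> of order \<open>\<beta>\<close>, without any cancellation. Let \<open>I\<close> be an interval.

  If \<open>J\<close> is an interval around \<open>x\<close>, then Hoelder's inequality and the \<open>A\<^sub>p\<^sub>,\<^sub>q\<close> condition give
  \<open>\<bar>J\<bar>\<^sup>\<beta>\<^sup>-\<^sup>1 \<integral>\<^sub>J \<bar>f\<bar> \<le> C \<parallel>f w\<parallel>\<^sub>L\<^sub>p\<^sub>(\<^sub>J\<^sub>) w\<^sup>q(J)\<^sup>-\<^sup>1\<^sup>/\<^sup>q\<close>. Moreover the masses \<open>w\<^sup>q(J)\<close> decay geometrically when
  \<open>J\<close> shrinks dyadically inside a fixed interval. For the scales above \<open>\<bar>I\<bar>\<close> the Morrey bound for \<open>f\<close>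
  turns the right-hand side into \<open>w\<^sup>q(J)\<^sup>\<kappa>\<^sup>/\<^sup>p\<^sup>-\<^sup>1\<^sup>/\<^sup>q\<close>, which is summable because \<open>\<kappa> < p / q\<close>. For the
  scale \<open>\<bar>I\<bar> / 2\<^sup>n\<close> the interval \<open>I\<close> is cut into \<open>2\<^sup>n\<close> pieces; writing \<open>\<parallel>f w\<parallel>\<^sup>q = \<parallel>f w\<parallel>\<^sup>p \<parallel>f w\<parallel>\<^sup>q\<^sup>-\<^sup>p\<close> on
  each piece and using the Morrey bound for the second factor only, the \<open>q\<close>-th powers sum up to a
  multiple of \<open>w\<^sup>q(I)\<^sup>\<kappa>\<^sup>q\<^sup>/\<^sup>p\<close> with a gain that is geometric in \<open>n\<close> because \<open>\<kappa> > 0\<close>.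
\<close>

subsection \<open>Real powers on \<open>[0, \<infinity>]\<close>\<close>

lemma epowr_ennreal: "0 \<le> c \<Longrightarrow> 0 < r \<Longrightarrow> epowr (ennreal c) r = ennreal (c powr r)"
  by (auto simp: epowr_def ennreal_eq_0_iff)

lemma epowr_ennreal_pos: "0 < c \<Longrightarrow> epowr (ennreal c) r = ennreal (c powr r)"
  by (auto simp: epowr_def ennreal_eq_0_iff)

lemma epowr_mono:
  assumes "x \<le> y" "0 < r" shows "epowr x r \<le> epowr y r"
proof (cases x; cases y)
  fix c d assume "0 \<le> c" "x = ennreal c" "0 \<le> d" "y = ennreal d"
  then show ?thesis using assms by (auto simp: epowr_ennreal intro!: ennreal_leI powr_mono2)
qed (use assms in \<open>auto simp: epowr_def top_unique\<close>)

lemma epowr_mult: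
  assumes "0 < r" shows "epowr (x * y) r = epowr x r * epowr y r"
proof (cases x; cases y)
  fix c d assume "0 \<le> c" "x = ennreal c" "0 \<le> d" "y = ennreal d"
  then show ?thesis using assms
    by (auto simp: epowr_ennreal powr_mult simp flip: ennreal_mult)
qed (use assms in \<open>auto simp: epowr_def ennreal_mult_top ennreal_top_mult ennreal_mult_eq_top_iff\<close>)

lemma epowr_epowr:
  assumes "0 < r" "0 < s" shows "epowr (epowr x r) s = epowr x (r * s)"
proof (cases x)
  case (real c)
  then show ?thesis using assms by (simp add: epowr_ennreal powr_powr)
qed (use assms in \<open>auto simp: epowr_def\<close>)

lemma epowr_1 [simp]: "epowr x 1 = x"
  by (cases x) (auto simp: epowr_def)

lemma measurable_epowr [measurable]:
  assumes [measurable]: "g \<in> borel_measurable M"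
  shows "(\<lambda>x. epowr (g x) r) \<in> borel_measurable M"
  unfolding epowr_def by measurable

lemma epowr_cancel_le:
  assumes "x \<le> epowr y r" "0 < r"
  shows "epowr x (1 / r) \<le> y"
  using epowr_mono[OF assms(1), of "1 / r"] assms(2) by (simp add: epowr_epowr)

text \<open>The sum is at most twice the maximum, an argument valid for every exponent
  \<open>0 < r\<close>.\<close>

lemma epowr_add_le:
  assumes "0 < r"
  shows "epowr (x + y) r \<le> ennreal (2 powr r) * (epowr x r + epowr y r)"
proof -
  have "x + y \<le> 2 * max x y"
    by (metis add_mono max.cobounded1 max.cobounded2 mult_2)
  then have "epowr (x + y) r \<le> epowr (ennreal 2 * max x y) r"
    using assms by (intro epowr_mono) auto
  also have "\<dots> = ennreal (2 powr r) * epowr (max x y) r"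
    using assms by (simp add: epowr_mult epowr_ennreal del: ennreal_numeral)
  also have "epowr (max x y) r \<le> epowr x r + epowr y r"
    by (auto simp: max_def)
  finally show ?thesis by (simp add: mult_left_mono)
qed

lemma le_suminf_ennreal: "a n \<le> (\<Sum>n. a n :: ennreal)"
  using sum_le_suminf[OF summableI, of "{n}" a] by simp

text \<open>A triangle inequality in \<open>\<ell>\<^sup>q\<close> with geometric weights: \<open>c n\<close> is at most \<open>r\<^sup>n\<close> times the
  \<open>q\<close>-th root of the weighted sum on the right.\<close>

lemma epowr_suminf_le:
  fixes c :: "nat \<Rightarrow> real"
  assumes "\<And>n. 0 \<le> c n" "0 < r" "r < 1" "0 < q"
  shows "epowr (\<Sum>n. ennreal (c n)) q
    \<le> ennreal ((1 / (1 - r)) powr q) * (\<Sum>n. ennreal (r powr (- real n * q) * c n powr q))"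
proof (cases "\<Sum>n. ennreal (r powr (- real n * q) * c n powr q)")
  case (real S)
  have c: "c n \<le> S powr (1 / q) * r ^ n" for n
  proof -
    have "ennreal (r powr (- real n * q) * c n powr q) \<le> ennreal S"
      using le_suminf_ennreal[of "\<lambda>n. ennreal (r powr (- real n * q) * c n powr q)" n]
      by (simp only: real(2))
    then have "r powr (- real n * q) * c n powr q \<le> S"
      using real by (simp add: ennreal_le_iff)
    then have "(r powr (- real n * q) * c n powr q) powr (1 / q) \<le> S powr (1 / q)"
      using assms by (intro powr_mono2) auto
    also have "(r powr (- real n * q) * c n powr q) powr (1 / q) = r powr (- real n) * c n"
      using assms(1)[of n] assms(2-4) by (simp only: powr_mult powr_powr) simp
    finally have "r ^ n * (r powr (- real n) * c n) \<le> r ^ n * S powr (1 / q)"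
      using assms by (intro mult_left_mono) auto
    moreover have "r ^ n * r powr (- real n) = 1"
      using assms by (simp add: powr_minus powr_realpow)
    ultimately show ?thesis
      by (simp only: mult.assoc[symmetric] mult.commute[of _ "r ^ n"] mult_1_left)
  qed
  have "(\<Sum>n. ennreal (c n)) \<le> (\<Sum>n. ennreal (S powr (1 / q) * r ^ n))"
    using c assms by (intro suminf_le ennreal_leI) auto
  also have "\<dots> = ennreal (S powr (1 / q) * (1 / (1 - r)))"
    using assms by (intro suminf_ennreal_eq sums_mult geometric_sums) auto
  finally have "epowr (\<Sum>n. ennreal (c n)) q \<le> epowr (ennreal (S powr (1 / q) * (1 / (1 - r)))) q"
    using assms by (intro epowr_mono) auto
  also have "\<dots> = ennreal ((S powr (1 / q) * (1 / (1 - r))) powr q)"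
    using assms by (intro epowr_ennreal) auto
  also have "\<dots> = ennreal ((1 / (1 - r)) powr q) * ennreal S"
    using assms real by (simp add: powr_mult powr_powr powr_divide mult.commute flip: ennreal_mult)
  finally show ?thesis using real by simp
next
  case top
  then show ?thesis using assms by (simp add: ennreal_mult_top)
qed

text \<open>The embedding of l^1 into l^r: with \<open>S\<close> the full sum, every
  \<open>a i\<close> is at most \<open>S\<close>, so (a i)^r <= S^(r-1) * a i, and summation gives
  S^r.\<close>

lemma epowr_suminf_powr_le:
  fixes a :: "nat \<Rightarrow> ennreal"
  assumes "1 \<le> r"
  shows "epowr (\<Sum>i. epowr (a i) r) (1 / r) \<le> (\<Sum>i. a i)"
proof (cases "\<Sum>i. a i")
  case (real S)
  have a: "a i \<le> ennreal S" for i
    using le_suminf_ennreal[of a i] by (simp only: real(2))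
  have "(\<Sum>i. epowr (a i) r) \<le> (\<Sum>i. ennreal (S powr (r - 1)) * a i)"
  proof (intro suminf_le)
    fix i
    obtain c where c: "0 \<le> c" "a i = ennreal c" using a[of i]
      by (cases "a i") (auto simp: top_unique)
    have "c powr r = c powr (r - 1) * c" 
      using c assms by (cases "c = 0") (auto simp: powr_diff)
    also have "\<dots> \<le> S powr (r - 1) * c"
      using c a[of i] real assms by (intro mult_right_mono powr_mono2) (auto simp: ennreal_le_iff)
    finally show "epowr (a i) r \<le> ennreal (S powr (r - 1)) * a i"
      using c assms by (simp add: epowr_ennreal flip: ennreal_mult)
  qed auto
  also have "\<dots> = ennreal (S powr (r - 1)) * ennreal S"
    by (simp add: real)
  also have "\<dots> = ennreal (S powr r)"
    using real by (cases "S = 0") (auto simp: powr_diff simp flip: ennreal_mult)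
  also have "\<dots> = epowr (ennreal S) r"
    using real assms by (simp add: epowr_ennreal)
  finally show ?thesis unfolding real(2) using assms by (intro epowr_cancel_le) auto
qed simp

subsection \<open>The Taylor remainder\<close>

text \<open>\<open>nderiv\<close> adds derivatives on the outside; peeling one off on the inside
  makes induction on the order possible, with \<open>b\<close> replaced by its derivative.\<close>

lemma nderiv_Suc: "nderiv (Suc k) b = nderiv k (nderiv (Suc 0) b)"
  by (simp add: nderiv_def funpow_Suc_right del: funpow.simps)

text \<open>Differentiation in \<open>x\<close> lowers each power by one and absorbs one factor of
  the factorial, so the Taylor polynomial of \<open>b\<close> turns into that of its derivative,
  with the base point \<open>y\<close> kept fixed.\<close>

lemma taylor_rem_has_vector_derivative:
  assumes "b differentiable (at x)"
  shows "((\<lambda>x. taylor_rem (Suc m) b x y) has_vector_derivative taylor_rem m (nderiv (Suc 0) b) x y) (at x)"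
proof -
  have b: "(b has_vector_derivative nderiv (Suc 0) b x) (at x)"
    using assms vector_derivative_works[of b "at x"] by (simp add: nderiv_def)
  have trm: "((\<lambda>x. complex_of_real (1 / fact (Suc k)) * nderiv (Suc k) b y
        * complex_of_real ((x - y) ^ Suc k)) has_vector_derivative
      complex_of_real (1 / fact k) * nderiv k (nderiv (Suc 0) b) y * complex_of_real ((x - y) ^ k)) (at x)" for k
  proof -
    have "((\<lambda>x. (x - y) ^ Suc k) has_real_derivative real (Suc k) * (x - y) ^ k) (at x)"
      by (rule derivative_eq_intros refl)+ simp
    then have "((\<lambda>x. complex_of_real ((x - y) ^ Suc k)) has_vector_derivative
        complex_of_real (real (Suc k) * (x - y) ^ k)) (at x)"
      unfolding has_real_derivative_iff_has_vector_derivative 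
      by (intro bounded_linear.has_vector_derivative[OF bounded_linear_of_real])
    then have "((\<lambda>x. complex_of_real (1 / fact (Suc k)) * nderiv (Suc k) b y
        * complex_of_real ((x - y) ^ Suc k)) has_vector_derivative
        complex_of_real (1 / fact (Suc k)) * nderiv (Suc k) b y
          * complex_of_real (real (Suc k) * (x - y) ^ k)) (at x)"
      by (rule has_vector_derivative_mult_right)
    also have "complex_of_real (1 / fact (Suc k)) * nderiv (Suc k) b y
          * complex_of_real (real (Suc k) * (x - y) ^ k)
        = (complex_of_real (1 / fact (Suc k)) * complex_of_real (real (Suc k)))
          * nderiv k (nderiv (Suc 0) b) y * complex_of_real ((x - y) ^ k)"
      by (simp only: nderiv_Suc[of k b] of_real_mult mult_ac)
    also have "complex_of_real (1 / fact (Suc k)) * complex_of_real (real (Suc k))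
        = complex_of_real (1 / fact k)"
      unfolding of_real_mult[symmetric] by (simp add: divide_simps)
    finally show ?thesis .
  qed
  have eq: "taylor_rem (Suc m) b x y = b x - (nderiv 0 b y + (\<Sum>k\<le>m. complex_of_real (1 / fact (Suc k))
      * nderiv (Suc k) b y * complex_of_real ((x - y) ^ Suc k)))" for x
    unfolding taylor_rem_def sum.atMost_Suc_shift by simp
  have "((\<lambda>x. b x - (nderiv 0 b y + (\<Sum>k\<le>m. complex_of_real (1 / fact (Suc k))
      * nderiv (Suc k) b y * complex_of_real ((x - y) ^ Suc k)))) has_vector_derivative
      nderiv (Suc 0) b x - (0 + (\<Sum>k\<le>m. complex_of_real (1 / fact k) * nderiv k (nderiv (Suc 0) b) y
        * complex_of_real ((x - y) ^ k)))) (at x)"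
    by (intro has_vector_derivative_diff has_vector_derivative_add has_vector_derivative_const
        has_vector_derivative_sum b trm)
  then show ?thesis unfolding eq[symmetric] by (simp add: taylor_rem_def[of m])
qed

text \<open>Induction on \<open>m\<close>: the remainder vanishes at \<open>x = y\<close>, and its
  derivative is a remainder of order one less for the derivative of \<open>b\<close>. The mean value
  inequality on the segment then contributes one more factor |x - y|.\<close>

lemma taylor_rem_bound:
  assumes "times_differentiable m b" "0 \<le> L" "0 < \<beta>"
    and "\<And>x y. norm (nderiv m b x - nderiv m b y) \<le> L * \<bar>x - y\<bar> powr \<beta>"
  shows "norm (taylor_rem m b x y) \<le> L * \<bar>x - y\<bar> powr \<beta> * \<bar>x - y\<bar> ^ m"
  using assms(1,4)
proof (induction m arbitrary: b x)
  case 0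
  then show ?case by (simp add: taylor_rem_def nderiv_def)
next
  case (Suc m)
  have diff: "b differentiable (at x)" for x
    using Suc.prems(1) by (auto simp: times_differentiable_def nderiv_def)
  have td: "times_differentiable m (nderiv (Suc 0) b)"
    using Suc.prems(1) by (auto simp: times_differentiable_def nderiv_Suc[symmetric])
  have IH: "norm (taylor_rem m (nderiv (Suc 0) b) x y) \<le> L * \<bar>x - y\<bar> powr \<beta> * \<bar>x - y\<bar> ^ m" for x
    using Suc.IH[OF td] Suc.prems(2) by (simp add: nderiv_Suc[symmetric])
  define R where "R = (\<lambda>z. taylor_rem (Suc m) b z y)"
  have R: "(R has_vector_derivative taylor_rem m (nderiv (Suc 0) b) z y) (at z within S)" for z S
    unfolding R_def by (rule has_vector_derivative_at_within[OF taylor_rem_has_vector_derivative[OF diff]])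
  have "norm (R x - R y) \<le> (L * \<bar>x - y\<bar> powr \<beta> * \<bar>x - y\<bar> ^ m) * norm (x - y)"
  proof (rule differentiable_bound[of "closed_segment y x"])
    fix z assume z: "z \<in> closed_segment y x"
    show "(R has_derivative (\<lambda>h. h *\<^sub>R taylor_rem m (nderiv (Suc 0) b) z y)) (at z within closed_segment y x)"
      using R[of z "closed_segment y x"] by (simp add: has_vector_derivative_def)
    have zy: "\<bar>z - y\<bar> \<le> \<bar>x - y\<bar>"
      using z by (auto simp: closed_segment_eq_real_ivl split: if_splits)
    have "onorm (\<lambda>h. h *\<^sub>R taylor_rem m (nderiv (Suc 0) b) z y) = norm (taylor_rem m (nderiv (Suc 0) b) z y)"
      using onorm_scaleR_left[of "\<lambda>h. h :: real" "taylor_rem m (nderiv (Suc 0) b) z y"]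
      by (simp add: onorm_id[unfolded id_def] bounded_linear_ident)
    also have "\<dots> \<le> L * \<bar>z - y\<bar> powr \<beta> * \<bar>z - y\<bar> ^ m" by (rule IH)
    \<comment> \<open>The induction bound is increasing in |z - y|, so its value at the far end
      \<open>x\<close> serves for the whole segment.\<close>
    also have "\<dots> \<le> L * \<bar>x - y\<bar> powr \<beta> * \<bar>x - y\<bar> ^ m"
      using assms zy by (intro mult_mono power_mono powr_mono2) auto
    finally show "onorm (\<lambda>h. h *\<^sub>R taylor_rem m (nderiv (Suc 0) b) z y) \<le> L * \<bar>x - y\<bar> powr \<beta> * \<bar>x - y\<bar> ^ m" .
  qed auto
  \<comment> \<open>Only the term of order 0 survives at the base point, and it equals
    \<open>b y\<close>.\<close>
  moreover have "R y = 0"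
    unfolding R_def taylor_rem_def sum.atMost_Suc_shift by (simp add: nderiv_def)
  ultimately show ?case by (simp add: R_def mult_ac)
qed

lemma lipschitz_space_bound:
  assumes "g \<in> lipschitz_space \<beta>"
  obtains L where "0 < L" "\<And>x y. norm (g x - g y) \<le> L * \<bar>x - y\<bar> powr \<beta>"
proof -
  obtain M where M: "\<And>x h. h \<noteq> 0 \<Longrightarrow> norm (g (x + h) - g x) / \<bar>h\<bar> powr \<beta> \<le> M"
    using assms unfolding lipschitz_space_def bdd_above_def by blast
  \<comment> \<open>The maximum with 1 makes the constant strictly positive even for constant
    \<open>g\<close>.\<close>
  have "norm (g x - g y) \<le> max M 1 * \<bar>x - y\<bar> powr \<beta>" for x y
  proof (cases "x = y")
    case False
    have "norm (g x - g y) / \<bar>x - y\<bar> powr \<beta> \<le> max M 1"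
      using M[of "x - y" y] False by simp
    then show ?thesis using False by (simp add: divide_simps split: if_splits)
  qed simp
  then show ?thesis using that[of "max M 1"] by auto
qed

lemma continuous_lipschitz_space:
  assumes "g \<in> lipschitz_space \<beta>" "0 < \<beta>"
  shows "continuous_on UNIV g"
proof -
  obtain L where L: "0 < L" "\<And>x y. norm (g x - g y) \<le> L * \<bar>x - y\<bar> powr \<beta>"
    using lipschitz_space_bound[OF assms(1)] by blast
  have "isCont g x" for x
  proof -
    have "((\<lambda>y. L * \<bar>y - x\<bar> powr \<beta>) \<longlongrightarrow> L * \<bar>x - x\<bar> powr \<beta>) (at x)"
      using assms by (intro tendsto_intros) auto
    then have lim: "((\<lambda>y. L * \<bar>y - x\<bar> powr \<beta>) \<longlongrightarrow> 0) (at x)"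
      using assms(2) by simp
    have "((\<lambda>y. g y - g x) \<longlongrightarrow> 0) (at x)"
      by (rule Lim_null_comparison[OF always_eventually lim]) (use L(2) in blast)
    then show ?thesis by (simp add: isCont_def LIM_zero_iff)
  qed
  then show ?thesis by (simp add: continuous_at_imp_continuous_on)
qed

subsection \<open>Oscillation and variation\<close>

lemma norm_square_eq_epowr: "ennreal ((norm z)\<^sup>2) = epowr (ennreal (norm z)) 2"
  by (simp add: epowr_ennreal powr_numeral)

text \<open>Partial sums telescope to \<open>H (e n) - H (e 0)\<close>, which is at most
  \<open>B\<close> uniformly in \<open>n\<close>.\<close>

lemma suminf_telescope_le:
  fixes H :: "real \<Rightarrow> real"
  assumes "\<And>\<epsilon>. 0 < \<epsilon> \<Longrightarrow> 0 \<le> H \<epsilon>" "\<And>\<epsilon>. 0 < \<epsilon> \<Longrightarrow> ennreal (H \<epsilon>) \<le> B"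
    and "\<And>\<delta> \<epsilon>. 0 < \<delta> \<Longrightarrow> \<delta> \<le> \<epsilon> \<Longrightarrow> H \<epsilon> \<le> H \<delta>"
    and "decseq e" "\<And>i. 0 < e i"
  shows "(\<Sum>i. ennreal (H (e (Suc i)) - H (e i))) \<le> B"
proof (rule suminf_le_const)
  fix n
  have "(\<Sum>i<n. ennreal (H (e (Suc i)) - H (e i))) = ennreal (\<Sum>i<n. H (e (Suc i)) - H (e i))"
    using assms(3-5) by (intro sum_ennreal) (auto simp: decseq_def)
  also have "\<dots> = ennreal (H (e n) - H (e 0))"
    using sum_lessThan_telescope[of "\<lambda>i. H (e i)" n] by simp
  also have "\<dots> \<le> ennreal (H (e n))"
    using assms(1)[of "e 0"] assms(5) by (intro ennreal_leI) auto
  also have "\<dots> \<le> B" using assms(2,5) by auto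
  finally show "(\<Sum>i<n. ennreal (H (e (Suc i)) - H (e i))) \<le> B" .
qed auto

text \<open>\<open>H\<close> is meant to be the truncated integral of an absolute value. Its
  monotonicity bounds the supremum over the i-th block by the increment of \<open>H\<close> across
  the whole block; the l^1 norm dominates the l^2 norm, and the increments telescope.\<close>

lemma oscillation_le:
  fixes H :: "real \<Rightarrow> real"
  assumes H: "\<And>\<epsilon>. 0 < \<epsilon> \<Longrightarrow> 0 \<le> H \<epsilon>" "\<And>\<epsilon>. 0 < \<epsilon> \<Longrightarrow> ennreal (H \<epsilon>) \<le> B"
    and diff: "\<And>\<delta> \<epsilon>. 0 < \<delta> \<Longrightarrow> \<delta> \<le> \<epsilon> \<Longrightarrow> norm (S \<delta> f x - S \<epsilon> f x) \<le> H \<delta> - H \<epsilon>"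
    and t: "decseq t" "\<And>i. 0 < t i"
  shows "oscillation t S f x \<le> B"
proof -
  have mono: "H \<epsilon> \<le> H \<delta>" if "0 < \<delta>" "\<delta> \<le> \<epsilon>" for \<delta> \<epsilon>
    using diff[OF that] norm_ge_zero[of "S \<delta> f x - S \<epsilon> f x"] by linarith
  have "(SUP (\<delta>, \<epsilon>) \<in> {(\<delta>, \<epsilon>). t (Suc i) \<le> \<delta> \<and> \<delta> < \<epsilon> \<and> \<epsilon> \<le> t i}.
      ennreal ((norm (S \<delta> f x - S \<epsilon> f x))\<^sup>2)) \<le> epowr (ennreal (H (t (Suc i)) - H (t i))) 2" for i
  proof (intro SUP_least, clarify)
    fix \<delta> \<epsilon> assume *: "t (Suc i) \<le> \<delta>" "\<delta> < \<epsilon>" "\<epsilon> \<le> t i"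
    have pos: "0 < \<delta>" using *(1) t(2)[of "Suc i"] by linarith
    have "norm (S \<delta> f x - S \<epsilon> f x) \<le> H \<delta> - H \<epsilon>"
      using pos * by (intro diff) auto
    also have "\<dots> \<le> H (t (Suc i)) - H (t i)"
      using mono[of "t (Suc i)" \<delta>] mono[of \<epsilon> "t i"] pos * t(2)[of "Suc i"] by auto
    finally show "ennreal ((norm (S \<delta> f x - S \<epsilon> f x))\<^sup>2) \<le> epowr (ennreal (H (t (Suc i)) - H (t i))) 2"
      unfolding norm_square_eq_epowr by (intro epowr_mono ennreal_leI) auto
  qed
  then have "oscillation t S f x
      \<le> epowr (\<Sum>i. epowr (ennreal (H (t (Suc i)) - H (t i))) 2) (1 / 2)"
    unfolding oscillation_def by (intro epowr_mono suminf_le) auto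
  also have "\<dots> \<le> (\<Sum>i. ennreal (H (t (Suc i)) - H (t i)))"
    by (rule epowr_suminf_powr_le) auto
  also have "\<dots> \<le> B"
    by (rule suminf_telescope_le) (use H mono t in auto)
  finally show ?thesis .
qed

text \<open>The same mechanism works for each admissible sequence separately; the bound
  \<open>B\<close> does not depend on the sequence and so survives the supremum.\<close>

lemma variation_le:
  fixes H :: "real \<Rightarrow> real"
  assumes H: "\<And>\<epsilon>. 0 < \<epsilon> \<Longrightarrow> 0 \<le> H \<epsilon>" "\<And>\<epsilon>. 0 < \<epsilon> \<Longrightarrow> ennreal (H \<epsilon>) \<le> B"
    and diff: "\<And>\<delta> \<epsilon>. 0 < \<delta> \<Longrightarrow> \<delta> \<le> \<epsilon> \<Longrightarrow> norm (S \<delta> f x - S \<epsilon> f x) \<le> H \<delta> - H \<epsilon>"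
    and \<rho>: "1 \<le> \<rho>"
  shows "variation \<rho> S f x \<le> B"
  unfolding variation_def
proof (intro SUP_least, clarify)
  fix e :: "nat \<Rightarrow> real" assume e: "decseq e" "\<forall>i. 0 < e i"
  have mono: "H \<epsilon> \<le> H \<delta>" if "0 < \<delta>" "\<delta> \<le> \<epsilon>" for \<delta> \<epsilon>
    using diff[OF that] norm_ge_zero[of "S \<delta> f x - S \<epsilon> f x"] by linarith
  have "epowr (\<Sum>i. ennreal (norm (S (e (Suc i)) f x - S (e i) f x) powr \<rho>)) (1 / \<rho>)
      = epowr (\<Sum>i. epowr (ennreal (norm (S (e (Suc i)) f x - S (e i) f x))) \<rho>) (1 / \<rho>)"
    using \<rho> by (simp add: epowr_ennreal)
  also have "\<dots> \<le> (\<Sum>i. ennreal (norm (S (e (Suc i)) f x - S (e i) f x)))"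
    using \<rho> by (rule epowr_suminf_powr_le)
  also have "\<dots> \<le> (\<Sum>i. ennreal (H (e (Suc i)) - H (e i)))"
    using e by (intro suminf_le ennreal_leI diff) (auto simp: decseq_Suc_iff)
  also have "\<dots> \<le> B"
    by (rule suminf_telescope_le) (use H mono e in auto)
  finally show "epowr (\<Sum>i. ennreal (norm (S (e (Suc i)) f x - S (e i) f x) powr \<rho>)) (1 / \<rho>) \<le> B" .
qed

section \<open>Measurability of oscillation and variation\<close>

lemma Rats_approx_pair:
  fixes a b :: real
  assumes "a \<le> \<delta>" "\<delta> < \<epsilon>" "\<epsilon> \<le> b"
  obtains r s where "\<And>n. r n \<in> \<rat>" "\<And>n. s n \<in> \<rat>" "\<And>n. a \<le> r n \<and> r n < s n \<and> s n \<le> b"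
    "r \<longlonglongrightarrow> \<delta>" "s \<longlonglongrightarrow> \<epsilon>"
proof -
  \<comment> \<open>The midpoint keeps the approximations apart: \<open>r\<close> tends to \<delta>
    from above and stays below \<open>c\<close>, \<open>s\<close> tends to \<epsilon> from below and
    stays above \<open>c\<close>. Hence both remain in \<open>[a, b]\<close> even if its ends are
    irrational.\<close>
  define c where "c = (\<delta> + \<epsilon>) / 2"
  have c: "\<delta> < c" "c < \<epsilon>" using assms by (auto simp: c_def)
  have "\<exists>r\<in>\<rat>. \<delta> < r \<and> r < min c (\<delta> + inverse (real (Suc n)))" for n
    using c by (intro Rats_dense_in_real) auto
  then obtain r where r: "\<And>n. r n \<in> \<rat>" "\<And>n. \<delta> < r n" "\<And>n. r n < min c (\<delta> + inverse (real (Suc n)))"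
    by metis
  have "\<exists>s\<in>\<rat>. max c (\<epsilon> - inverse (real (Suc n))) < s \<and> s < \<epsilon>" for n
    using c by (intro Rats_dense_in_real) auto
  then obtain s where s: "\<And>n. s n \<in> \<rat>" "\<And>n. s n < \<epsilon>" "\<And>n. max c (\<epsilon> - inverse (real (Suc n))) < s n"
    by metis
  have inv: "(\<lambda>n. inverse (real (Suc n))) \<longlonglongrightarrow> 0"
    by (rule LIMSEQ_inverse_real_of_nat)
  have "r \<longlonglongrightarrow> \<delta>"
  proof (rule tendsto_sandwich[OF _ _ tendsto_const])
    show "(\<lambda>n. \<delta> + inverse (real (Suc n))) \<longlonglongrightarrow> \<delta>"
      using tendsto_add[OF tendsto_const[of \<delta>] inv] by simp
  qed (use r(2,3) in \<open>auto intro!: always_eventually less_imp_le\<close>)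
  moreover have "s \<longlonglongrightarrow> \<epsilon>"
  proof (rule tendsto_sandwich[OF _ _ _ tendsto_const])
    show "(\<lambda>n. \<epsilon> - inverse (real (Suc n))) \<longlonglongrightarrow> \<epsilon>"
      using tendsto_diff[OF tendsto_const[of \<epsilon>] inv] by simp
  qed (use s(2,3) in \<open>auto intro!: always_eventually less_imp_le\<close>)
  moreover have "a \<le> r n \<and> r n < s n \<and> s n \<le> b" for n
    using r(2)[of n] r(3)[of n] s(2)[of n] s(3)[of n] assms by auto
  ultimately show ?thesis using r(1) s(1) that by blast
qed

text \<open>Continuity in the truncation parameter allows the supremum over each block to be taken
  over the countably many rational pairs.\<close>

lemma measurable_oscillation:
  assumes S: "\<And>\<epsilon>. 0 < \<epsilon> \<Longrightarrow> S \<epsilon> f \<in> borel_measurable M"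
    and cont: "\<And>x. continuous_on {0<..} (\<lambda>\<epsilon>. S \<epsilon> f x)"
    and t: "\<And>i. 0 < t i"
  shows "oscillation t S f \<in> borel_measurable M"
proof -
  define Q where "Q i = {(\<delta>, \<epsilon>). \<delta> \<in> \<rat> \<and> \<epsilon> \<in> \<rat> \<and> t (Suc i) \<le> \<delta> \<and> \<delta> < \<epsilon> \<and> \<epsilon> \<le> t i}" for i
  have Q: "countable (Q i)" for i
    by (rule countable_subset[of _ "\<rat> \<times> \<rat>"]) (auto simp: Q_def countable_rat)
  have eq: "(SUP (\<delta>, \<epsilon>) \<in> {(\<delta>, \<epsilon>). t (Suc i) \<le> \<delta> \<and> \<delta> < \<epsilon> \<and> \<epsilon> \<le> t i}.
      ennreal ((norm (S \<delta> f x - S \<epsilon> f x))\<^sup>2)) = (SUP (\<delta>, \<epsilon>) \<in> Q i. ennreal ((norm (S \<delta> f x - S \<epsilon> f x))\<^sup>2))"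
    (is "?L = ?R") for i x
  proof (rule antisym)
    show "?L \<le> ?R"
    proof (intro SUP_least, clarify)
      fix \<delta> \<epsilon> assume *: "t (Suc i) \<le> \<delta>" "\<delta> < \<epsilon>" "\<epsilon> \<le> t i"
      obtain r s where rs: "\<And>n. r n \<in> \<rat>" "\<And>n. s n \<in> \<rat>" "\<And>n. t (Suc i) \<le> r n \<and> r n < s n \<and> s n \<le> t i"
        "r \<longlonglongrightarrow> \<delta>" "s \<longlonglongrightarrow> \<epsilon>"
        using Rats_approx_pair[OF *] by blast
      have lim: "(\<lambda>n. S (u n) f x) \<longlonglongrightarrow> S c f x" if "u \<longlonglongrightarrow> c" "0 < c" for u c
      proof (rule isCont_tendsto_compose[OF _ that(1)])
        show "isCont (\<lambda>\<epsilon>. S \<epsilon> f x) c"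
          using cont[of x] that(2) by (simp add: continuous_on_eq_continuous_at[OF open_greaterThan])
      qed
      have pos: "0 < \<delta>" "0 < \<epsilon>" using * t[of "Suc i"] by linarith+
      have "(\<lambda>n. ennreal ((norm (S (r n) f x - S (s n) f x))\<^sup>2)) \<longlonglongrightarrow> ennreal ((norm (S \<delta> f x - S \<epsilon> f x))\<^sup>2)"
        by (intro tendsto_intros lim rs pos)
      then show "ennreal ((norm (S \<delta> f x - S \<epsilon> f x))\<^sup>2) \<le> ?R"
      proof (rule LIMSEQ_le_const2)
        show "\<exists>N. \<forall>n\<ge>N. ennreal ((norm (S (r n) f x - S (s n) f x))\<^sup>2) \<le> ?R"
          using rs(1-3) by (intro exI allI impI SUP_upper2[of "(r _, s _)"]) (auto simp: Q_def)
      qed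
    qed
    show "?R \<le> ?L" by (rule SUP_subset_mono) (auto simp: Q_def)
  qed
  have [measurable]: "(\<lambda>x. SUP (\<delta>, \<epsilon>) \<in> Q i. ennreal ((norm (S \<delta> f x - S \<epsilon> f x))\<^sup>2)) \<in> borel_measurable M" for i
  proof (rule borel_measurable_SUP[OF Q])
    fix z assume "z \<in> Q i"
    then have "0 < fst z" "0 < snd z" using t[of "Suc i"] by (auto simp: Q_def)
    then have [measurable]: "S (fst z) f \<in> borel_measurable M" "S (snd z) f \<in> borel_measurable M"
      using S by auto
    show "(\<lambda>x. case z of (\<delta>, \<epsilon>) \<Rightarrow> ennreal ((norm (S \<delta> f x - S \<epsilon> f x))\<^sup>2)) \<in> borel_measurable M"
      unfolding case_prod_beta by measurable
  qed
  show ?thesis unfolding oscillation_def[abs_def] eq by measurable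
qed

text \<open>Every finite initial piece of a sequence decreasing to \<open>0\<close> is approximated by the values
  \<open>\<lceil>k * e i\<rceil> / k\<close>, which are still decreasing; continuing them by halving the last one gives a
  countable family of admissible sequences.\<close>

definition dyadic_tail :: "real list \<Rightarrow> nat \<Rightarrow> real" where
  "dyadic_tail xs i = (if i < length xs then xs ! i else last xs * (1 / 2) ^ (i + 1 - length xs))"

lemma dyadic_tail:
  assumes "sorted_wrt (\<ge>) xs" "xs \<noteq> []" "\<And>x. x \<in> set xs \<Longrightarrow> 0 < x"
  shows "decseq (dyadic_tail xs)" "0 < dyadic_tail xs i" "dyadic_tail xs \<longlonglongrightarrow> 0"
proof -
  have last: "0 < last xs" using assms by simp
  show "0 < dyadic_tail xs i" using assms last by (auto simp: dyadic_tail_def)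
  show "decseq (dyadic_tail xs)"
  proof (rule decseq_SucI)
    fix n
    consider "Suc n < length xs" | "Suc n = length xs" | "length xs \<le> n" by linarith
    then show "dyadic_tail xs (Suc n) \<le> dyadic_tail xs n"
    proof cases
      case 1
      then show ?thesis using sorted_wrt_nth_less[OF assms(1), of n "Suc n"] by (simp add: dyadic_tail_def)
    next
      case 2
      then have "last xs = xs ! n" using assms(2) by (metis diff_Suc_1 last_conv_nth)
      then show ?thesis using 2 last by (simp add: dyadic_tail_def)
    next
      case 3
      then have "Suc n + 1 - length xs = Suc (n + 1 - length xs)" by linarith
      then show ?thesis using 3 last by (simp add: dyadic_tail_def)
    qed
  qed
  show "dyadic_tail xs \<longlonglongrightarrow> 0"
  proof (rule Lim_transform_eventually)
    show "(\<lambda>i. (last xs * (1 / 2) * 2 ^ length xs) * (1 / 2) ^ i) \<longlonglongrightarrow> 0"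
      by (intro tendsto_mult_right_zero LIMSEQ_power_zero) auto
    show "\<forall>\<^sub>F i in sequentially. (last xs * (1 / 2) * 2 ^ length xs) * (1 / 2) ^ i = dyadic_tail xs i"
      using eventually_ge_at_top[of "length xs"]
    proof eventually_elim
      case (elim i)
      then show ?case by (simp add: dyadic_tail_def power_diff power_one_over Suc_diff_le field_simps)
    qed
  qed
qed

lemma ceiling_approx: "(\<lambda>k. real_of_int \<lceil>real (Suc k) * x\<rceil> / real (Suc k)) \<longlonglongrightarrow> x"
proof (rule tendsto_sandwich[OF _ _ tendsto_const])
  show "(\<lambda>k. x + inverse (real (Suc k))) \<longlonglongrightarrow> x"
    using tendsto_add[OF tendsto_const[of x] LIMSEQ_inverse_real_of_nat] by simp
  show "\<forall>\<^sub>F k in sequentially. x \<le> real_of_int \<lceil>real (Suc k) * x\<rceil> / real (Suc k)"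
    by (intro always_eventually allI) (simp add: pos_le_divide_eq mult.commute del: of_nat_Suc)
  show "\<forall>\<^sub>F k in sequentially. real_of_int \<lceil>real (Suc k) * x\<rceil> / real (Suc k) \<le> x + inverse (real (Suc k))"
  proof (intro always_eventually allI)
    fix k
    have "real_of_int \<lceil>real (Suc k) * x\<rceil> \<le> real (Suc k) * x + 1" by linarith
    then show "real_of_int \<lceil>real (Suc k) * x\<rceil> / real (Suc k) \<le> x + inverse (real (Suc k))"
      by (simp add: pos_divide_le_eq distrib_left distrib_right mult.commute del: of_nat_Suc)
  qed
qed

lemma measurable_variation:
  assumes S: "\<And>\<epsilon>. 0 < \<epsilon> \<Longrightarrow> S \<epsilon> f \<in> borel_measurable M"
    and cont: "\<And>x. continuous_on {0<..} (\<lambda>\<epsilon>. S \<epsilon> f x)"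
    and \<rho>: "0 < \<rho>"
  shows "variation \<rho> S f \<in> borel_measurable M"
proof -
  define E where "E = {e :: nat \<Rightarrow> real. decseq e \<and> (\<forall>i. 0 < e i) \<and> e \<longlonglongrightarrow> 0}"
  define V where "V e x = epowr (\<Sum>i. ennreal (norm (S (e (Suc i)) f x - S (e i) f x) powr \<rho>)) (1 / \<rho>)"
    for e :: "nat \<Rightarrow> real" and x
  \<comment> \<open>Rational lists make the family countable; the intersection with \<open>E\<close>
    keeps only admissible sequences, so the supremum over \<open>E'\<close> is not larger.\<close>
  define E' where "E' = E \<inter> range (\<lambda>xs :: rat list. dyadic_tail (map of_rat xs))"
  have E': "countable E'" unfolding E'_def by (intro countable_Int2) auto
  have eq: "(SUP e \<in> E. V e x) = (SUP e \<in> E'. V e x)" (is "_ = ?R") for x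
  proof (rule antisym)
    show "(SUP e \<in> E. V e x) \<le> ?R"
    proof (intro SUP_least)
      fix e assume e: "e \<in> E"
      \<comment> \<open>Finite partial sums are compared with the \<rho>-th power of the countable
        supremum; passing to the series and taking the root come last.\<close>
      have "(\<Sum>i<n. ennreal (norm (S (e (Suc i)) f x - S (e i) f x) powr \<rho>)) \<le> epowr ?R \<rho>" for n
      proof -
        define r where "r k i = real_of_int \<lceil>real (Suc k) * e i\<rceil> / real (Suc k)" for k i
        \<comment> \<open>\<open>n\<close> consecutive differences involve \<open>n + 1\<close>
          points.\<close>
        define xs where "xs k = map (\<lambda>i. of_int \<lceil>real (Suc k) * e i\<rceil> / of_nat (Suc k) :: rat) [0..<Suc n]" for k
        have xs: "map of_rat (xs k) = map (r k) [0..<Suc n]" for k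
          by (simp add: xs_def r_def of_rat_divide del: of_nat_Suc upt_Suc)
        \<comment> \<open>Rounding up rather than down keeps the values positive.\<close>
        have r_pos: "0 < r k i" for k i
          using e by (simp add: r_def E_def zero_less_mult_iff del: of_nat_Suc)
        have r_dec: "r k j \<le> r k i" if "i \<le> j" for k i j
          using e that by (auto simp: r_def E_def decseq_def intro!: divide_right_mono ceiling_mono mult_left_mono)
        have inE: "dyadic_tail (map of_rat (xs k)) \<in> E'" for k
        proof -
          have "dyadic_tail (map (r k) [0..<Suc n]) \<in> E"
            unfolding E_def
            by (intro CollectI conjI allI dyadic_tail) 
               (auto simp: sorted_wrt_map r_pos sorted_wrt_iff_nth_less r_dec simp del: upt_Suc)
          then show ?thesis unfolding E'_def xs[symmetric] by auto
        qed
        have sum_le: "(\<Sum>i<n. ennreal (norm (S (r k (Suc i)) f x - S (r k i) f x) powr \<rho>)) \<le> epowr ?R \<rho>" for k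
        proof -
          define d where "d = dyadic_tail (map of_rat (xs k))"
          have d: "d i = r k i" if "i \<le> n" for i
            using that unfolding d_def xs dyadic_tail_def by (simp del: upt_Suc)
          have "(\<Sum>i<n. ennreal (norm (S (r k (Suc i)) f x - S (r k i) f x) powr \<rho>))
              = (\<Sum>i<n. ennreal (norm (S (d (Suc i)) f x - S (d i) f x) powr \<rho>))"
            by (intro sum.cong) (auto simp: d)
          also have "\<dots> \<le> (\<Sum>i. ennreal (norm (S (d (Suc i)) f x - S (d i) f x) powr \<rho>))"
            by (intro sum_le_suminf) auto
          also have "\<dots> = epowr (V d x) \<rho>"
            using \<rho> by (simp add: V_def epowr_epowr)
          also have "\<dots> \<le> epowr ?R \<rho>"
            using \<rho> inE by (intro epowr_mono SUP_upper) (auto simp: d_def)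
          finally show ?thesis .
        qed
        have lim: "(\<lambda>k. S (r k i) f x) \<longlonglongrightarrow> S (e i) f x" for i
        proof (rule isCont_tendsto_compose[where g = "\<lambda>\<epsilon>. S \<epsilon> f x"])
          show "isCont (\<lambda>\<epsilon>. S \<epsilon> f x) (e i)"
            using cont[of x] e by (simp add: continuous_on_eq_continuous_at[OF open_greaterThan] E_def)
          show "(\<lambda>k. r k i) \<longlonglongrightarrow> e i"
            unfolding r_def by (rule ceiling_approx)
        qed
        \<comment> \<open>The rounded points converge to \<open>e i\<close>; as the sum is finite,
          continuity in the truncation parameter carries the bound over to the limit.\<close>
        have "(\<lambda>k. \<Sum>i<n. ennreal (norm (S (r k (Suc i)) f x - S (r k i) f x) powr \<rho>))
            \<longlonglongrightarrow> (\<Sum>i<n. ennreal (norm (S (e (Suc i)) f x - S (e i) f x) powr \<rho>))"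
          using \<rho> by (intro tendsto_sum tendsto_ennrealI tendsto_powr2 tendsto_intros lim)
             auto
        then show ?thesis
          by (rule LIMSEQ_le_const2) (use sum_le in auto)
      qed
      then have "(\<Sum>i. ennreal (norm (S (e (Suc i)) f x - S (e i) f x) powr \<rho>)) \<le> epowr ?R \<rho>"
        by (intro suminf_le_const) auto
      then show "V e x \<le> ?R"
        unfolding V_def using \<rho> by (rule epowr_cancel_le)
    qed
    show "?R \<le> (SUP e \<in> E. V e x)" by (rule SUP_subset_mono) (auto simp: E'_def)
  qed
  have "(\<lambda>x. SUP e \<in> E'. V e x) \<in> borel_measurable M"
  proof (rule borel_measurable_SUP[OF E'])
    fix e assume "e \<in> E'"
    then have [measurable]: "S (e i) f \<in> borel_measurable M" for i
      using S by (auto simp: E'_def E_def)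
    show "V e \<in> borel_measurable M"
      unfolding V_def[abs_def] by measurable
  qed
  then show ?thesis
    unfolding variation_def[abs_def] E_def[symmetric] V_def[symmetric] eq .
qed

subsection \<open>Hoelder's inequality\<close>

text \<open>Young's inequality is applied pointwise after division by \<open>x\<close> and
  \<open>y\<close>, the roots of \<open>X\<close> and \<open>Y\<close>, which are upper bounds
  rather than exact integrals. If one of them is 0, the corresponding function vanishes almost
  everywhere.\<close>

lemma Hoelder_nn_integral:
  fixes f g :: "'a \<Rightarrow> real"
  assumes [measurable]: "f \<in> borel_measurable M" "g \<in> borel_measurable M"
    and nonneg: "\<And>x. 0 \<le> f x" "\<And>x. 0 \<le> g x"
    and ps: "0 < 1 / p" "0 < 1 / s" "1 / p + 1 / s = 1"
    and XY: "0 \<le> X" "0 \<le> Y"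
    and X: "(\<integral>\<^sup>+x. ennreal (f x powr p) \<partial>M) \<le> ennreal X"
    and Y: "(\<integral>\<^sup>+x. ennreal (g x powr s) \<partial>M) \<le> ennreal Y"
  shows "(\<integral>\<^sup>+x. ennreal (f x * g x) \<partial>M) \<le> ennreal (X powr (1 / p) * Y powr (1 / s))"
proof -
  have pos: "0 < p" "0 < s" using ps by auto
  have gt1: "1 < p" "1 < s"
  proof -
    have "1 / p < 1" "1 / s < 1" using ps by linarith+
    then show "1 < p" "1 < s" using pos by (auto simp: divide_simps)
  qed
  have zero: "(\<integral>\<^sup>+x. ennreal (h x * k x) \<partial>M) = 0"
    if [measurable]: "h \<in> borel_measurable M" "k \<in> borel_measurable M"
      and "\<And>x. 0 \<le> h x" "(\<integral>\<^sup>+x. ennreal (h x powr r) \<partial>M) \<le> 0" "0 < r" for h k :: "'a \<Rightarrow> real" and r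
  proof -
    have "(\<integral>\<^sup>+x. ennreal (h x powr r) \<partial>M) = 0" using that by simp
    then have "AE x in M. ennreal (h x powr r) = 0" by (subst (asm) nn_integral_0_iff_AE) auto
    then have "AE x in M. ennreal (h x * k x) = 0"
      by eventually_elim (simp add: ennreal_eq_0_iff)
    then show ?thesis by (subst nn_integral_0_iff_AE) auto
  qed
  consider "X = 0" | "Y = 0" | "0 < X" "0 < Y" using XY by linarith
  then show ?thesis
  proof cases
    case 1
    then show ?thesis using zero[of f g p] X nonneg pos by simp
  next
    case 2
    then show ?thesis using zero[of g f s] Y nonneg pos by (simp add: mult.commute)
  next
    case 3
    define x y where "x = X powr (1 / p)" and "y = Y powr (1 / s)"
    have xy: "0 < x" "0 < y" "x powr p = X" "y powr s = Y"
      using 3 pos by (auto simp: x_def y_def powr_powr)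
    have "(\<integral>\<^sup>+z. ennreal (f z * g z) \<partial>M)
        \<le> (\<integral>\<^sup>+z. ennreal (x * y / (p * X)) * ennreal (f z powr p)
              + ennreal (x * y / (s * Y)) * ennreal (g z powr s) \<partial>M)"
    proof (intro nn_integral_mono)
      fix z
      have "(f z / x) * (g z / y) \<le> (f z / x) powr p / p + (g z / y) powr s / s"
        using nonneg gt1 ps xy by (intro Youngs_inequality) auto
      also have "\<dots> = f z powr p / (p * X) + g z powr s / (s * Y)"
        using nonneg xy by (simp add: powr_divide mult.commute)
      finally have "f z * g z \<le> x * y * (f z powr p / (p * X) + g z powr s / (s * Y))"
        using xy by (simp add: field_simps)
      also have "\<dots> = x * y / (p * X) * f z powr p + x * y / (s * Y) * g z powr s"
        by (simp add: algebra_simps)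
      finally show "ennreal (f z * g z) \<le> ennreal (x * y / (p * X)) * ennreal (f z powr p)
              + ennreal (x * y / (s * Y)) * ennreal (g z powr s)"
        using xy pos 3 by (simp add: ennreal_leI flip: ennreal_mult ennreal_plus)
    qed
    also have "\<dots> = ennreal (x * y / (p * X)) * (\<integral>\<^sup>+z. ennreal (f z powr p) \<partial>M)
              + ennreal (x * y / (s * Y)) * (\<integral>\<^sup>+z. ennreal (g z powr s) \<partial>M)"
      by (subst nn_integral_add) (auto simp: nn_integral_cmult)
    also have "\<dots> \<le> ennreal (x * y / (p * X)) * ennreal X + ennreal (x * y / (s * Y)) * ennreal Y"
      by (intro add_mono mult_left_mono X Y) auto
    also have "\<dots> = ennreal (x * y / (p * X) * X + x * y / (s * Y) * Y)"
      using xy pos 3 by (simp flip: ennreal_mult ennreal_plus)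
    also have "x * y / (p * X) * X + x * y / (s * Y) * Y = x * y * (1 / p + 1 / s)"
      using 3 by (simp add: field_simps)
    finally show ?thesis by (simp only: ps x_def y_def mult_1_right)
  qed
qed

lemma measurable_ident_lebesgue [measurable]: "(\<lambda>x :: real. x) \<in> borel_measurable lebesgue"
  by (simp add: measurable_completion)

lemma nn_integral_Icc_split:
  fixes a b c :: real
  assumes [measurable]: "h \<in> borel_measurable lebesgue" and "a \<le> c" "c \<le> b"
  shows "(\<integral>\<^sup>+x\<in>{a..b}. h x \<partial>lebesgue) = (\<integral>\<^sup>+x\<in>{a..c}. h x \<partial>lebesgue) + (\<integral>\<^sup>+x\<in>{c..b}. h x \<partial>lebesgue)"
proof -
  \<comment> \<open>Both intervals on the right contain \<open>c\<close>; a single point is a null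
    set.\<close>
  have "AE x in lebesgue. x \<noteq> c"
    by (intro AE_I[of _ _ "{c}"]) auto
  then have "AE x in lebesgue. h x * indicator {a..b} x
      = h x * indicator {a..c} x + h x * indicator {c..b} x"
    by eventually_elim (use assms(2,3) in \<open>auto split: split_indicator\<close>)
  then have "(\<integral>\<^sup>+x\<in>{a..b}. h x \<partial>lebesgue)
      = (\<integral>\<^sup>+x. h x * indicator {a..c} x + h x * indicator {c..b} x \<partial>lebesgue)"
    by (rule nn_integral_cong_AE)
  also have "\<dots> = (\<integral>\<^sup>+x\<in>{a..c}. h x \<partial>lebesgue) + (\<integral>\<^sup>+x\<in>{c..b}. h x \<partial>lebesgue)"
    by (rule nn_integral_add) measurable
  finally show ?thesis .
qed

lemma nn_integral_Icc_mono:
  assumes "c \<le> a" "b \<le> d"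
  shows "(\<integral>\<^sup>+x\<in>{a..b::real}. h x \<partial>lebesgue) \<le> (\<integral>\<^sup>+x\<in>{c..d}. h x \<partial>lebesgue)"
  using assms by (intro nn_integral_mono) (auto split: split_indicator)

subsection \<open>Weights with the \<open>A\<^sub>p\<^sub>,\<^sub>q\<close> condition\<close>

text \<open>\<open>u a b\<close> and \<open>s a b\<close> are the masses \<open>w\<^sup>q([a, b])\<close> and \<open>w\<^sup>-\<^sup>p\<^sup>'([a, b])\<close>.\<close>

locale Apq_weight =
  fixes p q \<beta> A :: real and w :: "real \<Rightarrow> real" and u s :: "real \<Rightarrow> real \<Rightarrow> real"
  assumes p: "1 < p" and \<beta>: "0 < \<beta>" and p_less: "p < 1 / \<beta>" and q: "1 / q = 1 / p - \<beta>"
    and w_measurable [measurable]: "w \<in> borel_measurable lebesgue"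
    and w_nonneg: "\<And>x. 0 \<le> w x"
    and w_pos: "AE x in lebesgue. 0 < w x"
    and u_eq: "\<And>a b. a < b \<Longrightarrow> (\<integral>\<^sup>+x\<in>{a..b}. ennreal (w x powr q) \<partial>lebesgue) = ennreal (u a b)"
    and s_eq: "\<And>a b. a < b \<Longrightarrow>
      (\<integral>\<^sup>+x\<in>{a..b}. ennreal (w x powr (- (p / (p - 1)))) \<partial>lebesgue) = ennreal (s a b)"
    and u_pos: "\<And>a b. a < b \<Longrightarrow> 0 < u a b"
    and s_pos: "\<And>a b. a < b \<Longrightarrow> 0 < s a b"
    and Apq: "\<And>a b. a < b \<Longrightarrow>
      u a b powr (1 / q) * s a b powr (1 - 1 / p) \<le> A * (b - a) powr (1 - \<beta>)"
begin

lemma q_inverse_pos: "0 < 1 / q"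
proof -
  have "\<beta> < 1 / p" using p \<beta> p_less by (simp add: field_simps)
  then show ?thesis using q by simp
qed

lemma q_pos: "0 < q"
  using q_inverse_pos by simp

lemma p_less_q: "p < q"
proof -
  have "1 / q < 1 / p" using q \<beta> by linarith
  then show ?thesis using p q_pos by (simp add: divide_simps split: if_splits)
qed

lemma \<beta>_less: "\<beta> < 1"
proof -
  have "p * \<beta> < 1" using p_less \<beta> by (simp add: field_simps)
  moreover have "\<beta> < p * \<beta>" using p \<beta> by simp
  ultimately show ?thesis by linarith
qed

lemma u_mono:
  assumes "c \<le> a" "a < b" "b \<le> d" shows "u a b \<le> u c d"
proof -
  have "ennreal (u a b) \<le> ennreal (u c d)"
    using assms u_eq[of a b] u_eq[of c d] nn_integral_Icc_mono[of c a b d "\<lambda>x. ennreal (w x powr q)"]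
    by auto
  then show ?thesis using u_pos[of c d] assms by (simp add: ennreal_le_iff)
qed

lemma s_mono:
  assumes "c \<le> a" "a < b" "b \<le> d" shows "s a b \<le> s c d"
proof -
  have "ennreal (s a b) \<le> ennreal (s c d)"
    using assms s_eq[of a b] s_eq[of c d]
      nn_integral_Icc_mono[of c a b d "\<lambda>x. ennreal (w x powr (- (p / (p - 1))))"]
    by auto
  then show ?thesis using s_pos[of c d] assms by (simp add: ennreal_le_iff)
qed

lemma u_add:
  assumes "a < c" "c < b" shows "u a b = u a c + u c b"
proof -
  have "ennreal (u a b) = ennreal (u a c + u c b)"
    using assms u_eq[of a b] u_eq[of a c] u_eq[of c b] u_pos[of a c] u_pos[of c b]
      nn_integral_Icc_split[of "\<lambda>x. ennreal (w x powr q)" a c b]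
    by simp
  then show ?thesis
    using u_pos[of a b] u_pos[of a c] u_pos[of c b] assms by (subst (asm) ennreal_inj) auto
qed

text \<open>Hoelder's inequality for \<open>1 = w\<^sup>\<alpha> w\<^sup>-\<^sup>\<alpha>\<close> with \<open>\<alpha> = 1 / (1 - \<beta>)\<close>: the converse of the
  \<open>A\<^sub>p\<^sub>,\<^sub>q\<close> condition holds on every interval.\<close>

lemma length_le:
  assumes "a < b"
  shows "(b - a) powr (1 - \<beta>) \<le> u a b powr (1 / q) * s a b powr (1 - 1 / p)"
proof -
  \<comment> \<open>Because 1/q + 1/P = 1 - \<beta>, this choice makes \<open>q / \<alpha>\<close>
    and \<open>P / \<alpha>\<close> conjugate exponents, and the powers of \<open>w\<close> in
    Hoelder's inequality become exactly w^q and w^(-P).\<close>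
  define \<alpha> where "\<alpha> = 1 / (1 - \<beta>)"
  have \<alpha>: "0 < \<alpha>" "\<alpha> * (1 - \<beta>) = 1" using \<beta>_less by (auto simp: \<alpha>_def)
  define P where "P = p / (p - 1)"
  have P: "0 < P" "1 / P = 1 - 1 / p" using p by (auto simp: P_def field_simps)
  define f where "f x = indicator {a..b} x * w x powr \<alpha>" for x
  define g where "g x = indicator {a..b} x * w x powr (- \<alpha>)" for x
  have [measurable]: "f \<in> borel_measurable lebesgue" "g \<in> borel_measurable lebesgue"
    unfolding f_def g_def by measurable
  have "AE x in lebesgue. indicator {a..b} x = ennreal (f x * g x)"
    using w_pos by eventually_elim (auto simp: f_def g_def powr_minus split: split_indicator)
  then have "(\<integral>\<^sup>+x. indicator {a..b} x \<partial>lebesgue) = (\<integral>\<^sup>+x. ennreal (f x * g x) \<partial>lebesgue)"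
    by (rule nn_integral_cong_AE)
  also have "\<dots> \<le> ennreal (u a b powr (1 / (q / \<alpha>)) * s a b powr (1 / (P / \<alpha>)))"
  proof (rule Hoelder_nn_integral)
    show "(\<integral>\<^sup>+x. ennreal (f x powr (q / \<alpha>)) \<partial>lebesgue) \<le> ennreal (u a b)"
      unfolding u_eq[OF assms, symmetric] using \<alpha>
      by (intro nn_integral_mono) (auto simp: f_def powr_powr split: split_indicator)
    show "(\<integral>\<^sup>+x. ennreal (g x powr (P / \<alpha>)) \<partial>lebesgue) \<le> ennreal (s a b)"
      unfolding s_eq[OF assms, symmetric] P_def[symmetric] using \<alpha>
      by (intro nn_integral_mono) (auto simp: g_def powr_powr split: split_indicator)
    have "1 / (q / \<alpha>) + 1 / (P / \<alpha>) = \<alpha> * (1 / q + 1 / P)"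
      by (simp add: algebra_simps)
    also have "\<dots> = 1" using \<alpha> P q by simp
    finally show "1 / (q / \<alpha>) + 1 / (P / \<alpha>) = 1" .
  qed (use \<alpha> P q_pos u_pos[OF assms] s_pos[OF assms] in \<open>auto simp: f_def g_def\<close>)
  finally have "ennreal (b - a) \<le> ennreal (u a b powr (1 / (q / \<alpha>)) * s a b powr (1 / (P / \<alpha>)))"
    using assms by simp
  then have "b - a \<le> u a b powr (1 / (q / \<alpha>)) * s a b powr (1 / (P / \<alpha>))"
    by (simp add: ennreal_le_iff)
  then have "(b - a) powr (1 - \<beta>) \<le> (u a b powr (1 / (q / \<alpha>)) * s a b powr (1 / (P / \<alpha>))) powr (1 - \<beta>)"
    using assms \<beta>_less by (intro powr_mono2) auto
  also have "\<dots> = u a b powr (\<alpha> * (1 - \<beta>) * (1 / q)) * s a b powr (\<alpha> * (1 - \<beta>) * (1 / P))"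
    by (simp add: powr_mult powr_powr)
  finally show ?thesis using \<alpha> P by simp
qed

text \<open>On \<open>[0, 1]\<close> the weight condition \<open>Apq\<close> and its converse
  \<open>length_le\<close> squeeze 1 below \<open>A\<close>.\<close>

lemma A_ge_1: "1 \<le> A"
proof -
  have "1 * (1 - 0) powr (1 - \<beta>) \<le> A * (1 - 0) powr (1 - \<beta>)"
    using length_le[of 0 1] Apq[of 0 1] by simp
  then show ?thesis by simp
qed

text \<open>\<open>Apq\<close> on \<open>[a, b]\<close> is set against \<open>length_le\<close> on
  \<open>[c, d]\<close>. Since \<open>s c d\<close> is at most \<open>s a b\<close>, that factor
  cancels and only the masses \<open>u\<close> and the lengths remain.\<close>

lemma u_doubling:
  assumes "a \<le> c" "c < d" "d \<le> b"
  shows "u a b \<le> (A * ((b - a) / (d - c)) powr (1 - \<beta>)) powr q * u c d"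
proof -
  have pos: "0 < u a b" "0 < u c d" "0 < s a b" "0 < s c d" "0 < s a b powr (1 - 1 / p)"
    using assms s_pos[of a b] by (auto intro: u_pos s_pos)
  have "u a b powr (1 / q) * s a b powr (1 - 1 / p) * (d - c) powr (1 - \<beta>)
      \<le> (A * (b - a) powr (1 - \<beta>)) * (u c d powr (1 / q) * s c d powr (1 - 1 / p))"
    using assms by (intro mult_mono Apq length_le order_trans[OF _ Apq[of a b]]) auto
  also have "\<dots> \<le> (A * (b - a) powr (1 - \<beta>)) * (u c d powr (1 / q) * s a b powr (1 - 1 / p))"
    using assms p pos by (intro mult_left_mono powr_mono2 s_mono order_trans[OF _ Apq[of a b]]) auto
  finally have "u a b powr (1 / q) * (d - c) powr (1 - \<beta>) \<le> A * (b - a) powr (1 - \<beta>) * u c d powr (1 / q)"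
    using pos(5) by (simp add: mult.commute mult.left_commute)
  then have "u a b powr (1 / q) \<le> A * ((b - a) / (d - c)) powr (1 - \<beta>) * u c d powr (1 / q)"
    using assms by (simp add: powr_divide field_simps)
  then have "(u a b powr (1 / q)) powr q \<le> (A * ((b - a) / (d - c)) powr (1 - \<beta>) * u c d powr (1 / q)) powr q"
    using q_pos by (intro powr_mono2) auto
  also have "\<dots> = (A * ((b - a) / (d - c)) powr (1 - \<beta>)) powr q * u c d"
    using A_ge_1 q_pos pos by (simp add: powr_mult powr_powr)
  finally show ?thesis using q_pos pos by (simp add: powr_powr)
qed

text \<open>The doubling constant for a subinterval that takes up at least a quarter of the
  length.\<close>

definition "D = (A * 4 powr (1 - \<beta>)) powr q"

text \<open>The share of the mass that can remain once a part with at least the fraction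
  \<open>1 / D\<close> of it is removed.\<close>

definition "\<gamma> = 1 - 1 / D"

lemma D_gt_1: "1 < D"
proof -
  have "1 < (4::real) powr (1 - \<beta>)" using \<beta>_less by (intro gr_one_powr) auto
  also have "\<dots> \<le> A * 4 powr (1 - \<beta>)" using A_ge_1 by simp
  finally show ?thesis unfolding D_def using q_pos by (intro gr_one_powr) auto
qed

lemma \<gamma>: "0 < \<gamma>" "\<gamma> < 1"
  using D_gt_1 by (auto simp: \<gamma>_def)

text \<open>The two end pieces together have half the length of \<open>[a, b]\<close>, so one of
  them has at least a quarter. By doubling it carries mass at least \<open>u a b / D\<close>, which
  \<open>[c, d]\<close> misses.\<close>

lemma u_half:
  assumes "a \<le> c" "c < d" "d \<le> b" "b - a = 2 * (d - c)"
  shows "u c d \<le> \<gamma> * u a b"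
proof -
  have sub: "u a b \<le> D * u x y" if "a \<le> x" "x < y" "y \<le> b" "b - a \<le> 4 * (y - x)" for x y
  proof -
    have "u a b \<le> (A * ((b - a) / (y - x)) powr (1 - \<beta>)) powr q * u x y"
      using that by (intro u_doubling) auto
    also have "\<dots> \<le> D * u x y"
      unfolding D_def using that A_ge_1 \<beta>_less q_pos u_pos[of x y] 
      by (intro mult_right_mono powr_mono2 mult_left_mono) (auto simp: field_simps)
    finally show ?thesis .
  qed
  have "4 * (c - a) \<ge> b - a \<or> 4 * (b - d) \<ge> b - a"
    using assms(4) by argo
  then consider "4 * (c - a) \<ge> b - a" | "4 * (b - d) \<ge> b - a" by blast
  then have "u c d + u a b / D \<le> u a b"
  proof cases
    case 1
    then have "a < c" using assms by auto
    then have "u a b / D \<le> u a c" using sub[of a c] 1 assms D_gt_1 by (simp add: field_simps)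
    moreover have "u a c + u c d \<le> u a b"
      using u_add[of a c d] u_mono[of a a d b] \<open>a < c\<close> assms by auto
    ultimately show ?thesis by simp
  next
    case 2
    then have "d < b" using assms by auto
    then have "u a b / D \<le> u d b" using sub[of d b] 2 assms D_gt_1 by (simp add: field_simps)
    moreover have "u c d + u d b \<le> u a b"
      using u_add[of c d b] u_mono[of a c b b] \<open>d < b\<close> assms by auto
    ultimately show ?thesis by simp
  qed
  then show ?thesis by (simp add: \<gamma>_def algebra_simps)
qed

text \<open>Halving is iterated along a chain of intervals between \<open>[c, d]\<close> and
  \<open>[a, b]\<close>, wherever \<open>[c, d]\<close> lies inside.\<close>

lemma u_scale:
  assumes "a \<le> c" "c < d" "d \<le> b" "b - a = 2 ^ n * (d - c)"
  shows "u c d \<le> \<gamma> ^ n * u a b"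
  using assms
proof (induction n arbitrary: a b)
  case 0
  then have "a = c" "b = d" by auto
  then show ?case by simp
next
  case (Suc n)
  define l where "l = 2 ^ n * (d - c)"
  have l: "d - c \<le> l" "b - a = 2 * l" 
    using Suc.prems(2,4) mult_right_mono[of 1 "2 ^ n" "d - c"] by (auto simp: l_def)
  \<comment> \<open>The next interval of the chain: it has half the length, starts at
    \<open>c\<close> if it then fits into \<open>[a, b]\<close>, and is otherwise pushed left until
    it ends at \<open>b\<close>.\<close>
  define a' where "a' = min c (b - l)"
  have a': "a \<le> a'" "a' \<le> c" "d \<le> a' + l" "a' + l \<le> b"
    using Suc.prems(1-3) l unfolding a'_def min_def by (simp_all split: if_split)
  have "u c d \<le> \<gamma> ^ n * u a' (a' + l)"
    using a' Suc.prems by (intro Suc.IH) (auto simp: l_def)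
  also have "\<dots> \<le> \<gamma> ^ n * (\<gamma> * u a b)"
    using a' l Suc.prems \<gamma> by (intro mult_left_mono u_half) auto
  finally show ?case by (simp add: mult_ac)
qed

text \<open>Hoelder's inequality for g = (g w) w^(-1) with exponents \<open>p\<close> and
  \<open>P\<close>; \<open>Apq\<close> then trades the mass of w^(-P) for the length and the mass of
  w^q.\<close>

lemma average_le:
  assumes [measurable]: "g \<in> borel_measurable lebesgue" and "\<And>x. 0 \<le> g x" and "a < b" "0 \<le> X"
    and X: "(\<integral>\<^sup>+x\<in>{a..b}. ennreal ((g x * w x) powr p) \<partial>lebesgue) \<le> ennreal X"
  shows "(\<integral>\<^sup>+x\<in>{a..b}. ennreal (g x) \<partial>lebesgue)
    \<le> ennreal (A * (b - a) powr (1 - \<beta>) * (X powr (1 / p) * u a b powr (- (1 / q))))"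
proof -
  define P where "P = p / (p - 1)"
  have P: "0 < P" "1 / P = 1 - 1 / p" using p by (auto simp: P_def field_simps)
  have "AE x in lebesgue. ennreal (g x) * indicator {a..b} x
      = ennreal ((indicator {a..b} x * (g x * w x)) * (indicator {a..b} x * w x powr (- 1)))"
    using w_pos by eventually_elim (auto simp: powr_minus_divide split: split_indicator)
  then have "(\<integral>\<^sup>+x\<in>{a..b}. ennreal (g x) \<partial>lebesgue) = (\<integral>\<^sup>+x. ennreal
      ((indicator {a..b} x * (g x * w x)) * (indicator {a..b} x * w x powr (- 1))) \<partial>lebesgue)"
    by (rule nn_integral_cong_AE)
  also have "\<dots> \<le> ennreal (X powr (1 / p) * s a b powr (1 / P))"
  proof (rule Hoelder_nn_integral)
    show "(\<integral>\<^sup>+x. ennreal ((indicator {a..b} x * (g x * w x)) powr p) \<partial>lebesgue) \<le> ennreal X"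
      by (rule order_trans[OF nn_integral_mono X]) (use p in \<open>auto split: split_indicator\<close>)
    show "(\<integral>\<^sup>+x. ennreal ((indicator {a..b} x * w x powr (- 1)) powr P) \<partial>lebesgue) \<le> ennreal (s a b)"
      unfolding s_eq[OF \<open>a < b\<close>, symmetric] P_def[symmetric]
    proof (intro nn_integral_mono)
      fix x
      have "(w x powr (- 1)) powr P = w x powr (- P)"
        by (subst powr_powr) simp
      then show "ennreal ((indicator {a..b} x * w x powr (- 1)) powr P)
          \<le> ennreal (w x powr (- P)) * indicator {a..b} x"
        by (auto split: split_indicator simp del: powr_neg_one)
    qed
  qed (use assms p P s_pos[of a b] w_nonneg in auto)
  also have "X powr (1 / p) * s a b powr (1 / P)
      \<le> A * (b - a) powr (1 - \<beta>) * (X powr (1 / p) * u a b powr (- (1 / q)))"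
  proof -
    have "s a b powr (1 / P) \<le> A * (b - a) powr (1 - \<beta>) / u a b powr (1 / q)"
      using Apq[OF \<open>a < b\<close>] u_pos[OF \<open>a < b\<close>] by (simp add: P(2) pos_le_divide_eq mult.commute)
    then have "X powr (1 / p) * s a b powr (1 / P)
        \<le> X powr (1 / p) * (A * (b - a) powr (1 - \<beta>) / u a b powr (1 / q))"
      by (intro mult_left_mono) auto
    then show ?thesis by (simp add: powr_minus_divide mult_ac)
  qed
  finally show ?thesis by (simp add: ennreal_leI)
qed

end

subsection \<open>The fractional integral on weighted Morrey spaces\<close>

lemma dyadic_scale_above:
  fixes L z :: real
  assumes "0 < L" "L < z"
  obtains n :: nat where "2 ^ n * L / 2 < z" "z \<le> 2 ^ n * L"
proof -
  define n where "n = (LEAST n. z \<le> 2 ^ n * L)"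
  obtain k :: nat where "z / L < 2 ^ k" using real_arch_pow[of 2 "z / L"] by auto
  then have ex: "z \<le> 2 ^ k * L" using assms by (simp add: field_simps)
  have n: "z \<le> 2 ^ n * L" unfolding n_def by (rule LeastI[where P = "\<lambda>n. z \<le> 2 ^ n * L", OF ex])
  \<comment> \<open>\<open>n = 0\<close> is excluded by \<open>L < z\<close>, so minimality can be
    applied to the predecessor.\<close>
  then obtain l where l: "n = Suc l" using assms by (cases n) auto
  have "\<not> z \<le> 2 ^ l * L" using not_less_Least[of l "\<lambda>n. z \<le> 2 ^ n * L"] l by (simp add: n_def)
  then show ?thesis using that[of n] n l by simp
qed

lemma dyadic_scale_below:
  fixes L z :: real
  assumes "0 < z" "z \<le> L"
  obtains n :: nat where "L / 2 ^ n / 2 < z" "z \<le> L / 2 ^ n"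
proof -
  define n where "n = (LEAST n. L / 2 ^ n < z)"
  obtain k :: nat where "L / z < 2 ^ k" using real_arch_pow[of 2 "L / z"] by auto
  then have ex: "L / 2 ^ k < z" using assms by (simp add: field_simps)
  have n: "L / 2 ^ n < z" unfolding n_def by (rule LeastI[where P = "\<lambda>n. L / 2 ^ n < z", OF ex])
  \<comment> \<open>The least exponent overshoots by one: \<open>n = 0\<close> is excluded by
    \<open>z \<le> L\<close>, and the predecessor \<open>l\<close> is the required scale.\<close>
  then obtain l where l: "n = Suc l" using assms by (cases n) auto
  have "\<not> L / 2 ^ l < z" using not_less_Least[of l "\<lambda>n. L / 2 ^ n < z"] l by (simp add: n_def)
  then show ?thesis using that[of l] n l by (simp add: mult.commute)
qed

lemma subinterval_of_partition:
  fixes x a h :: real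
  assumes "0 < N" "a \<le> x" "x \<le> a + real N * h"
  shows "\<exists>j<N. a + real j * h \<le> x \<and> x \<le> a + (real j + 1) * h"
  using assms
proof (induction N)
  case (Suc N)
  show ?case
  proof (cases "N = 0 \<or> a + real N * h < x")
    case True
    then show ?thesis using Suc.prems by (intro exI[of _ N]) (auto simp: algebra_simps)
  next
    case False
    then obtain j where "j < N" "a + real j * h \<le> x \<and> x \<le> a + (real j + 1) * h"
      using Suc by auto
    then show ?thesis by (intro exI[of _ j]) auto
  qed
qed simp

text \<open>The Riesz potential of order \<beta> up to a normalising constant. At
  \<open>y = x\<close> the kernel is 0 because \<open>0 powr _ = 0\<close>, which affects a single
  point.\<close>

definition frac_int :: "real \<Rightarrow> (real \<Rightarrow> real) \<Rightarrow> real \<Rightarrow> ennreal" where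
  "frac_int \<beta> g x = (\<integral>\<^sup>+y. ennreal (\<bar>x - y\<bar> powr (\<beta> - 1) * g y) \<partial>lebesgue)"

text \<open>\<open>F\<close> bounds the Morrey norm of \<open>g\<close>; the assumption
  \<open>morrey\<close> is the norm inequality raised to the power \<open>p\<close>, with the mass
  moved to the right.\<close>

locale Apq_morrey = Apq_weight +
  fixes \<kappa> F :: real and g :: "real \<Rightarrow> real"
  assumes \<kappa>: "0 < \<kappa>" "\<kappa> < p / q"
    and g_measurable [measurable]: "g \<in> borel_measurable lebesgue" and g_nonneg: "\<And>x. 0 \<le> g x"
    and F: "0 \<le> F"
    and morrey: "\<And>a b. a < b \<Longrightarrow>
      (\<integral>\<^sup>+x\<in>{a..b}. ennreal ((g x * w x) powr p) \<partial>lebesgue) \<le> ennreal (F powr p * u a b powr \<kappa>)"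
begin

definition "X a b = enn2real (\<integral>\<^sup>+x\<in>{a..b}. ennreal ((g x * w x) powr p) \<partial>lebesgue)"

lemma X_nonneg: "0 \<le> X a b"
  by (simp add: X_def)

lemma X_eq:
  assumes "a < b"
  shows "(\<integral>\<^sup>+x\<in>{a..b}. ennreal ((g x * w x) powr p) \<partial>lebesgue) = ennreal (X a b)"
  using morrey[OF assms] unfolding X_def by (intro ennreal_enn2real[symmetric]) (auto simp: less_top[symmetric] top_unique)

lemma X_le: "a < b \<Longrightarrow> X a b \<le> F powr p * u a b powr \<kappa>"
  using morrey[of a b] X_eq[of a b] by (simp add: ennreal_le_iff)

lemma X_add:
  assumes "a < c" "c < b" shows "X a b = X a c + X c b"
proof -
  have "ennreal (X a b) = ennreal (X a c + X c b)"
    using assms X_eq[of a b] X_eq[of a c] X_eq[of c b] X_nonneg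
      nn_integral_Icc_split[of "\<lambda>x. ennreal ((g x * w x) powr p)" a c b]
    by simp
  then show ?thesis by (subst (asm) ennreal_inj) (auto simp: X_nonneg)
qed

lemma X_mono:
  assumes "c \<le> a" "a < b" "b \<le> d" shows "X a b \<le> X c d"
proof -
  have "ennreal (X a b) \<le> ennreal (X c d)"
    using assms X_eq[of a b] X_eq[of c d]
      nn_integral_Icc_mono[of c a b d "\<lambda>x. ennreal ((g x * w x) powr p)"]
    by auto
  then show ?thesis using X_nonneg by (simp add: ennreal_le_iff)
qed

text \<open>The first exponent drives the decay over scales above the interval and comes from
  \<open>\<kappa> < p / q\<close>; the second drives the decay below it and comes from
  \<open>0 < \<kappa>\<close> and \<open>p < q\<close>.\<close>

lemma exponent_pos: "0 < 1 / q - \<kappa> / p" "0 < \<kappa> * (q / p - 1)"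
  using \<kappa> p q_pos p_less_q by (auto simp: field_simps)

text \<open>The contribution of one dyadic scale. For h/2 < |x - y| <= h the kernel is at most
  (h/2)^(\<beta>-1), and if \<open>x\<close> is in the middle third of an interval of length 3h,
  then \<open>y\<close> is in that interval. The length factor of \<open>average_le\<close>
  compensates the kernel up to 6^(1-\<beta>), as 3h = 6 (h/2).\<close>

lemma scale_term:
  assumes "0 < h"
  shows "ennreal ((h / 2) powr (\<beta> - 1)) * (\<integral>\<^sup>+y\<in>{c..c + 3 * h}. ennreal (g y) \<partial>lebesgue)
    \<le> ennreal (A * 6 powr (1 - \<beta>) * (X c (c + 3 * h) powr (1 / p) * u c (c + 3 * h) powr (- (1 / q))))"
proof -
  have "(\<integral>\<^sup>+y\<in>{c..c + 3 * h}. ennreal (g y) \<partial>lebesgue)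
    \<le> ennreal (A * (c + 3 * h - c) powr (1 - \<beta>)
        * (X c (c + 3 * h) powr (1 / p) * u c (c + 3 * h) powr (- (1 / q))))"
    using assms X_nonneg by (intro average_le) (auto simp: g_nonneg X_eq)
  then have "ennreal ((h / 2) powr (\<beta> - 1)) * (\<integral>\<^sup>+y\<in>{c..c + 3 * h}. ennreal (g y) \<partial>lebesgue)
    \<le> ennreal ((h / 2) powr (\<beta> - 1)) * ennreal (A * (3 * h) powr (1 - \<beta>)
        * (X c (c + 3 * h) powr (1 / p) * u c (c + 3 * h) powr (- (1 / q))))"
    by (intro mult_left_mono) auto
  also have "\<dots> = ennreal ((h / 2) powr (\<beta> - 1) * (A * (3 * h) powr (1 - \<beta>)
        * (X c (c + 3 * h) powr (1 / p) * u c (c + 3 * h) powr (- (1 / q)))))"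
    using A_ge_1 by (intro ennreal_mult[symmetric]) auto
  also have "(h / 2) powr (\<beta> - 1) * (A * (3 * h) powr (1 - \<beta>)
        * (X c (c + 3 * h) powr (1 / p) * u c (c + 3 * h) powr (- (1 / q))))
      = A * ((h / 2) powr (\<beta> - 1) * (3 * h) powr (1 - \<beta>))
        * (X c (c + 3 * h) powr (1 / p) * u c (c + 3 * h) powr (- (1 / q)))"
    by (simp only: mult_ac)
  also have "(h / 2) powr (\<beta> - 1) * (3 * h) powr (1 - \<beta>) = 6 powr (1 - \<beta>)"
  proof -
    have "(3 * h) powr (1 - \<beta>) = (6 * (h / 2)) powr (1 - \<beta>)" by simp
    also have "\<dots> = 6 powr (1 - \<beta>) * (h / 2) powr (1 - \<beta>)"
      using assms by (intro powr_mult)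
    finally show ?thesis
      using assms by (simp add: powr_add[symmetric] mult.left_commute del: powr_divide)
  qed
  finally show ?thesis .
qed

lemma kernel_le:
  assumes "0 < h" "h / 2 < z"
  shows "z powr (\<beta> - 1) \<le> (h / 2) powr (\<beta> - 1)"
  using assms \<beta>_less by (intro powr_mono2') auto

text \<open>At the n-th scale the Morrey bound leaves \<open>F\<close> times a negative power of the
  mass of the enlarged interval. This mass is at least \<gamma>^(-n) times \<open>u a b\<close>, so
  the scales form a geometric series.\<close>

lemma outer_le:
  assumes "a \<le> x" "x \<le> b" "a < b"
  shows "(\<integral>\<^sup>+y. ennreal (\<bar>x - y\<bar> powr (\<beta> - 1) * g y) * indicator {y. b - a < \<bar>x - y\<bar>} y \<partial>lebesgue)
    \<le> ennreal (A * 6 powr (1 - \<beta>) / (1 - \<gamma> powr (1 / q - \<kappa> / p)) * F * u a b powr (\<kappa> / p - 1 / q))"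
proof -
  define L where "L = b - a"
  define h where "h n = 2 ^ n * L" for n :: nat
  \<comment> \<open>Since b = a + L and L <= h n, the interval from \<open>c n\<close> to
    \<open>c n + 3 * h n\<close> contains every \<open>y\<close> within distance \<open>h n\<close>
    of a point of \<open>[a, b]\<close>.\<close>
  define c where "c n = a - h n" for n
  define e where "e = 1 / q - \<kappa> / p"
  define B where "B = A * 6 powr (1 - \<beta>) * F * u a b powr (- e)"
  have e: "0 < e" using exponent_pos by (simp add: e_def)
  have L: "0 < L" using assms by (simp add: L_def)
  have h: "0 < h n" for n using L by (simp add: h_def)
  have hL: "L \<le> h n" for n using L mult_right_mono[of 1 "2 ^ n" L] by (simp add: h_def)
  have B: "0 \<le> B" using A_ge_1 F by (simp add: B_def)
  have "(\<integral>\<^sup>+y. ennreal (\<bar>x - y\<bar> powr (\<beta> - 1) * g y) * indicator {y. b - a < \<bar>x - y\<bar>} y \<partial>lebesgue)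
    \<le> (\<integral>\<^sup>+y. (\<Sum>n. ennreal ((h n / 2) powr (\<beta> - 1)) * (ennreal (g y) * indicator {c n..c n + 3 * h n} y)) \<partial>lebesgue)"
  proof (intro nn_integral_mono)
    fix y
    show "ennreal (\<bar>x - y\<bar> powr (\<beta> - 1) * g y) * indicator {y. b - a < \<bar>x - y\<bar>} y
      \<le> (\<Sum>n. ennreal ((h n / 2) powr (\<beta> - 1)) * (ennreal (g y) * indicator {c n..c n + 3 * h n} y))"
    proof (cases "L < \<bar>x - y\<bar>")
      case True
      then obtain n where n: "h n / 2 < \<bar>x - y\<bar>" "\<bar>x - y\<bar> \<le> h n"
        using dyadic_scale_above[OF L, of "\<bar>x - y\<bar>"] by (auto simp: h_def)
      then have "y \<in> {c n..c n + 3 * h n}"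
        using assms hL[of n] by (auto simp: c_def L_def)
      then have "ennreal (\<bar>x - y\<bar> powr (\<beta> - 1) * g y) * indicator {y. b - a < \<bar>x - y\<bar>} y
          \<le> ennreal ((h n / 2) powr (\<beta> - 1)) * (ennreal (g y) * indicator {c n..c n + 3 * h n} y)"
        using kernel_le[OF h n(1)] g_nonneg[of y] True
        by (auto simp: L_def simp flip: ennreal_mult intro!: ennreal_leI mult_right_mono)
      also have "\<dots> \<le> (\<Sum>n. ennreal ((h n / 2) powr (\<beta> - 1)) * (ennreal (g y) * indicator {c n..c n + 3 * h n} y))"
        by (rule le_suminf_ennreal)
      finally show ?thesis .
    qed (simp add: L_def)
  qed
  also have "\<dots> = (\<Sum>n. ennreal ((h n / 2) powr (\<beta> - 1)) * (\<integral>\<^sup>+y\<in>{c n..c n + 3 * h n}. ennreal (g y) \<partial>lebesgue))"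
    by (subst nn_integral_suminf) (auto simp: nn_integral_cmult)
  also have "\<dots> \<le> (\<Sum>n. ennreal (B * (\<gamma> powr e) ^ n))"
  proof (intro suminf_le allI)
    fix n
    define U where "U = u (c n) (c n + 3 * h n)"
    have U: "0 < U" using h[of n] u_pos[of "c n" "c n + 3 * h n"] by (simp add: U_def)
    \<comment> \<open>The enlarged interval is 2^n times as long as the triple of
      \<open>[a, b]\<close>, so the scaling lemma starts from that triple.\<close>
    have "u (a - L) (a + 2 * L) \<le> \<gamma> ^ n * U"
      unfolding U_def using L hL[of n] by (intro u_scale) (auto simp: c_def h_def)
    moreover have "u a b \<le> u (a - L) (a + 2 * L)"
      using L assms by (intro u_mono) (auto simp: L_def)
    ultimately have ub: "u a b \<le> \<gamma> ^ n * U" by linarith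
    have "X (c n) (c n + 3 * h n) powr (1 / p) \<le> (F powr p * U powr \<kappa>) powr (1 / p)"
      unfolding U_def using h[of n] X_nonneg p by (intro powr_mono2 X_le) auto
    also have "\<dots> = F * U powr (\<kappa> / p)"
      using F p by (simp add: powr_mult powr_powr)
    finally have "X (c n) (c n + 3 * h n) powr (1 / p) * U powr (- (1 / q)) \<le> F * U powr (\<kappa> / p) * U powr (- (1 / q))"
      by (intro mult_right_mono) auto
    also have "\<dots> = F * U powr (- e)" by (simp add: e_def powr_add[symmetric])
    also have "\<dots> \<le> F * ((\<gamma> powr e) ^ n * u a b powr (- e))"
    proof (intro mult_left_mono F)
      have "(\<gamma> ^ n * U) powr (- e) \<le> u a b powr (- e)"
        using ub e u_pos[OF \<open>a < b\<close>] by (intro powr_mono2') auto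
      then have "(\<gamma> powr e) ^ n * (\<gamma> ^ n * U) powr (- e) \<le> (\<gamma> powr e) ^ n * u a b powr (- e)"
        by (intro mult_left_mono) auto
      moreover have "(\<gamma> powr e) ^ n * (\<gamma> ^ n * U) powr (- e) = U powr (- e)"
        using \<gamma> by (simp add: powr_mult powr_realpow[symmetric] powr_powr powr_add[symmetric] mult.commute)
      ultimately show "U powr (- e) \<le> (\<gamma> powr e) ^ n * u a b powr (- e)" by simp
    qed
    finally have "A * 6 powr (1 - \<beta>) * (X (c n) (c n + 3 * h n) powr (1 / p) * U powr (- (1 / q)))
        \<le> A * 6 powr (1 - \<beta>) * (F * ((\<gamma> powr e) ^ n * u a b powr (- e)))"
      using A_ge_1 by (intro mult_left_mono) auto
    also have "\<dots> = B * (\<gamma> powr e) ^ n" by (simp add: B_def mult_ac)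
    finally show "ennreal ((h n / 2) powr (\<beta> - 1)) * (\<integral>\<^sup>+y\<in>{c n..c n + 3 * h n}. ennreal (g y) \<partial>lebesgue)
        \<le> ennreal (B * (\<gamma> powr e) ^ n)"
      unfolding U_def by (intro order_trans[OF scale_term[OF h]] ennreal_leI)
  qed auto
  also have "\<dots> = ennreal (B * (1 / (1 - \<gamma> powr e)))"
  proof (intro suminf_ennreal_eq sums_mult geometric_sums)
    show "norm (\<gamma> powr e) < 1" using \<gamma> e powr_less_mono2[of e \<gamma> 1] by auto
  qed (use B in auto)
  finally show ?thesis by (simp add: B_def e_def mult_ac)
qed

end

section \<open>Scales below the length of the interval\<close>

context Apq_morrey
begin

text \<open>The exponent of the gain: the Morrey factor at the n-th scale shrinks like
  \<gamma>^(\<kappa> n) and enters with the power \<open>q / p - 1\<close>.\<close>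

definition "\<eta> = \<kappa> * (q / p - 1)"

text \<open>Half of the gain is spent as the weight of \<open>epowr_suminf_le\<close>, since
  \<open>ratio powr q\<close> is \<gamma>^(\<eta>/2); the other half makes the sum over the scales
  converge.\<close>

definition "ratio = \<gamma> powr (\<eta> / (2 * q))"

text \<open>The interval \<open>[a, b]\<close> is cut into \<open>2\<^sup>n\<close> pieces of length \<open>h = (b - a) / 2\<^sup>n\<close>; \<open>piece a b n j\<close>
  bounds the contribution of \<open>|x - y| \<approx> h\<close> for \<open>x\<close> in the \<open>j\<close>-th piece, whose triple starts at
  \<open>a + (j - 1) h\<close>.\<close>

definition "piece a b n j =
  (let h = (b - a) / 2 ^ n; c = a + (real j - 1) * h in
    A * 6 powr (1 - \<beta>) * (X c (c + 3 * h) powr (1 / p) * u c (c + 3 * h) powr (- (1 / q))))"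

text \<open>The right-hand side of \<open>epowr_suminf_le\<close> as a function of \<open>x\<close>,
  the indicators selecting the piece that contains \<open>x\<close>. A common endpoint of two closed
  pieces counts twice, which only enlarges the sum.\<close>

definition "inner_sum a b x =
  (\<Sum>n. \<Sum>j<2 ^ n. ennreal (ratio powr (- real n * q) * piece a b n j powr q) *
    indicator {a + real j * ((b - a) / 2 ^ n)..a + (real j + 1) * ((b - a) / 2 ^ n)} x)"

lemma ratio: "0 < ratio" "ratio < 1" "ratio powr q = \<gamma> powr (\<eta> / 2)"
proof -
  have "0 < \<eta> / (2 * q)" using exponent_pos(2) q_pos by (simp add: \<eta>_def)
  then show "ratio < 1" unfolding ratio_def using \<gamma> powr_less_mono2[of "\<eta> / (2 * q)" \<gamma> 1] by simp
  show "0 < ratio" unfolding ratio_def using \<gamma> by simp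
  show "ratio powr q = \<gamma> powr (\<eta> / 2)" unfolding ratio_def using q_pos by (simp add: powr_powr)
qed

lemma piece_nonneg: "0 \<le> piece a b n j"
  using A_ge_1 by (simp add: piece_def Let_def)

lemma measurable_inner_sum [measurable]: "inner_sum a b \<in> borel_measurable lebesgue"
  unfolding inner_sum_def[abs_def] by measurable

text \<open>At each scale the relevant \<open>y\<close> lie in the triple of the piece containing
  \<open>x\<close>, so the integral is at most a sum with one \<open>piece\<close> per scale, to
  which \<open>epowr_suminf_le\<close> applies.\<close>

lemma inner_le:
  assumes "a \<le> x" "x \<le> b" "a < b"
  shows "epowr (\<integral>\<^sup>+y. ennreal (\<bar>x - y\<bar> powr (\<beta> - 1) * g y) * indicator {y. \<bar>x - y\<bar> \<le> b - a} y \<partial>lebesgue) q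
    \<le> ennreal ((1 / (1 - ratio)) powr q) * inner_sum a b x"
proof -
  define L where "L = b - a"
  define h where "h n = L / 2 ^ n" for n :: nat
  have L: "0 < L" using assms by (simp add: L_def)
  have h: "0 < h n" for n using L by (simp add: h_def)
  have "\<exists>j<2 ^ n. a + real j * h n \<le> x \<and> x \<le> a + (real j + 1) * h n" for n
    using assms by (intro subinterval_of_partition) (auto simp: h_def L_def)
  then obtain j where j: "\<And>n. j n < 2 ^ n" "\<And>n. a + real (j n) * h n \<le> x" "\<And>n. x \<le> a + (real (j n) + 1) * h n"
    by metis
  define c where "c n = a + (real (j n) - 1) * h n" for n
  have "(\<integral>\<^sup>+y. ennreal (\<bar>x - y\<bar> powr (\<beta> - 1) * g y) * indicator {y. \<bar>x - y\<bar> \<le> b - a} y \<partial>lebesgue)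
    \<le> (\<integral>\<^sup>+y. (\<Sum>n. ennreal ((h n / 2) powr (\<beta> - 1)) * (ennreal (g y) * indicator {c n..c n + 3 * h n} y)) \<partial>lebesgue)"
  proof (intro nn_integral_mono)
    fix y
    show "ennreal (\<bar>x - y\<bar> powr (\<beta> - 1) * g y) * indicator {y. \<bar>x - y\<bar> \<le> b - a} y
      \<le> (\<Sum>n. ennreal ((h n / 2) powr (\<beta> - 1)) * (ennreal (g y) * indicator {c n..c n + 3 * h n} y))"
    \<comment> \<open>The distance 0 belongs to no dyadic scale; there the kernel is
      \<open>0 powr _ = 0\<close>.\<close>
    proof (cases "0 < \<bar>x - y\<bar> \<and> \<bar>x - y\<bar> \<le> L")
      case True
      then obtain n where n: "h n / 2 < \<bar>x - y\<bar>" "\<bar>x - y\<bar> \<le> h n"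
        using dyadic_scale_below[of "\<bar>x - y\<bar>" L] by (auto simp: h_def)
      then have "y \<in> {c n..c n + 3 * h n}"
        using j(2)[of n] j(3)[of n] by (auto simp: c_def algebra_simps abs_le_iff)
      then have "ennreal (\<bar>x - y\<bar> powr (\<beta> - 1) * g y) * indicator {y. \<bar>x - y\<bar> \<le> b - a} y
          \<le> ennreal ((h n / 2) powr (\<beta> - 1)) * (ennreal (g y) * indicator {c n..c n + 3 * h n} y)"
        using kernel_le[OF h n(1)] g_nonneg[of y] True
        by (auto simp: L_def simp flip: ennreal_mult intro!: ennreal_leI mult_right_mono)
      also have "\<dots> \<le> (\<Sum>n. ennreal ((h n / 2) powr (\<beta> - 1)) * (ennreal (g y) * indicator {c n..c n + 3 * h n} y))"
        by (rule le_suminf_ennreal)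
      finally show ?thesis .
    qed (auto simp: L_def)
  qed
  also have "\<dots> = (\<Sum>n. ennreal ((h n / 2) powr (\<beta> - 1)) * (\<integral>\<^sup>+y\<in>{c n..c n + 3 * h n}. ennreal (g y) \<partial>lebesgue))"
    by (subst nn_integral_suminf) (auto simp: nn_integral_cmult)
  also have "\<dots> \<le> (\<Sum>n. ennreal (piece a b n (j n)))"
    by (intro suminf_le allI order_trans[OF scale_term[OF h]])
      (auto simp: piece_def Let_def c_def h_def L_def)
  finally have "epowr (\<integral>\<^sup>+y. ennreal (\<bar>x - y\<bar> powr (\<beta> - 1) * g y) * indicator {y. \<bar>x - y\<bar> \<le> b - a} y \<partial>lebesgue) q
      \<le> epowr (\<Sum>n. ennreal (piece a b n (j n))) q"
    using q_pos by (rule epowr_mono)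
  also have "\<dots> \<le> ennreal ((1 / (1 - ratio)) powr q)
      * (\<Sum>n. ennreal (ratio powr (- real n * q) * piece a b n (j n) powr q))"
    using ratio q_pos by (intro epowr_suminf_le piece_nonneg) auto
  also have "\<dots> \<le> ennreal ((1 / (1 - ratio)) powr q) * inner_sum a b x"
    unfolding inner_sum_def
  proof (intro mult_left_mono suminf_le allI)
    fix n
    have "ennreal (ratio powr (- real n * q) * piece a b n (j n) powr q)
       = ennreal (ratio powr (- real n * q) * piece a b n (j n) powr q) *
      indicator {a + real (j n) * ((b - a) / 2 ^ n)..a + (real (j n) + 1) * ((b - a) / 2 ^ n)} x"
      using j(2)[of n] j(3)[of n] by (simp add: h_def L_def)
    also have "\<dots> \<le> (\<Sum>j<2 ^ n. ennreal (ratio powr (- real n * q) * piece a b n j powr q) *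
    indicator {a + real j * ((b - a) / 2 ^ n)..a + (real j + 1) * ((b - a) / 2 ^ n)} x)"
      using j(1)[of n] by (intro member_le_sum) auto
    finally show "ennreal (ratio powr (- real n * q) * piece a b n (j n) powr q) \<le> \<dots>" .
  qed auto
  finally show ?thesis .
qed

text \<open>Each cell of length \<open>h\<close> belongs to at most three of the triples.\<close>

lemma sum_X_le:
  assumes "0 < h"
  shows "(\<Sum>j<N. X (a + (real j - 1) * h) (a + (real j - 1) * h + 3 * h)) \<le> 3 * X (a - h) (a + (real N + 1) * h)"
proof -
  \<comment> \<open>The index is shifted by one: \<open>Y 0\<close> is the cell to the left of
    \<open>a\<close>, so the \<open>N\<close> triples use the \<open>N + 2\<close> cells from
    \<open>Y 0\<close> to \<open>Y (N + 1)\<close>.\<close>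
  define Y where "Y k = X (a + (real k - 1) * h) (a + real k * h)" for k
  have Y: "0 \<le> Y k" for k by (simp add: Y_def X_nonneg)
  have X3: "X (a + (real j - 1) * h) (a + (real j - 1) * h + 3 * h) = Y j + Y (Suc j) + Y (Suc (Suc j))" for j
  proof -
    have "X (a + (real j - 1) * h) (a + (real j - 1) * h + 3 * h)
      = X (a + (real j - 1) * h) (a + (real j + 1) * h) + X (a + (real j + 1) * h) (a + (real j - 1) * h + 3 * h)"
      using assms by (intro X_add) (auto simp: algebra_simps)
    also have "X (a + (real j - 1) * h) (a + (real j + 1) * h)
      = X (a + (real j - 1) * h) (a + real j * h) + X (a + real j * h) (a + (real j + 1) * h)"
      using assms by (intro X_add) (auto simp: algebra_simps)
    finally show ?thesis by (simp add: Y_def algebra_simps)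
  qed
  have total: "(\<Sum>k<Suc M. Y k) = X (a - h) (a + real M * h)" for M
  proof (induction M)
    case (Suc M)
    have "X (a - h) (a + real (Suc M) * h) = X (a - h) (a + real M * h) + X (a + real M * h) (a + real (Suc M) * h)"
      using assms by (intro X_add) (auto simp: algebra_simps intro: add_pos_nonneg)
    then show ?case using Suc by (simp add: Y_def)
  qed (simp add: Y_def)
  have sub: "(\<Sum>j<N. Y (j + i)) \<le> (\<Sum>k<N + 2. Y k)" if "i \<le> 2" for i
  proof -
    have "(\<Sum>j<N. Y (j + i)) = (\<Sum>k\<in>(\<lambda>j. j + i) ` {..<N}. Y k)"
      by (subst sum.reindex) auto
    also have "\<dots> \<le> (\<Sum>k<N + 2. Y k)"
      using that Y by (intro sum_mono2) auto
    finally show ?thesis .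
  qed
  have "(\<Sum>j<N. X (a + (real j - 1) * h) (a + (real j - 1) * h + 3 * h))
      = (\<Sum>j<N. Y (j + 0)) + (\<Sum>j<N. Y (j + 1)) + (\<Sum>j<N. Y (j + 2))"
    by (simp add: X3 sum.distrib)
  also have "\<dots> \<le> 3 * (\<Sum>k<N + 2. Y k)"
    using sub[of 0] sub[of 1] sub[of 2] by simp
  also have "(\<Sum>k<N + 2. Y k) = X (a - h) (a + (real N + 1) * h)"
    using total[of "N + 1"] by (simp add: add.commute)
  finally show ?thesis .
qed

text \<open>In X^(q/p) = X^(q/p-1) X the first factor is estimated by the Morrey bound and the decay
  of the masses; only the second is summed over \<open>j\<close>, using the bounded overlap of the
  triples. The mass of a piece cancels against that of its triple.\<close>

lemma piece_sum_le:
  assumes "a < b"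
  defines "U \<equiv> u (a - (b - a)) (b + (b - a))"
  shows "(\<Sum>j<2 ^ n. ratio powr (- real n * q) * piece a b n j powr q *
      u (a + real j * ((b - a) / 2 ^ n)) (a + (real j + 1) * ((b - a) / 2 ^ n)))
    \<le> 3 * (A * 6 powr (1 - \<beta>)) powr q * F powr q * U powr (\<kappa> * q / p) * (\<gamma> powr (\<eta> / 2)) ^ n"
proof -
  define L where "L = b - a"
  define h where "h = L / 2 ^ n"
  define c where "c j = a + (real j - 1) * h" for j
  \<comment> \<open>The Morrey bound for \<open>X\<close> on the triple of \<open>[a, b]\<close>,
    which contains the triples of all pieces.\<close>
  define M where "M = F powr p * U powr \<kappa>"
  have L: "0 < L" using assms by (simp add: L_def)
  have h: "0 < h" "h \<le> L" "2 ^ n * h = L"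
    using L divide_left_mono[of 1 "2 ^ n" L] by (auto simp: h_def)
  have U: "0 < U" using assms by (auto simp: U_def intro!: u_pos)
  have M: "0 \<le> M" by (simp add: M_def)
  have piece: "piece a b n j powr q * u (a + real j * h) (a + (real j + 1) * h)
      \<le> (A * 6 powr (1 - \<beta>)) powr q * (\<gamma> powr \<eta>) ^ n * M powr (q / p - 1) * X (c j) (c j + 3 * h)"
    if j: "j < 2 ^ n" for j
  proof -
    define V where "V = u (c j) (c j + 3 * h)"
    define Xj where "Xj = X (c j) (c j + 3 * h)"
    have V: "0 < V" using h by (auto simp: V_def intro!: u_pos)
    have Xj: "0 \<le> Xj" by (simp add: Xj_def X_nonneg)
    have "(real j + 1) * h \<le> 2 ^ n * h"
    proof (intro mult_right_mono)
      have "real (Suc j) \<le> real (2 ^ n)"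
        using j by (simp only: of_nat_le_iff Suc_le_eq)
      then show "real j + 1 \<le> 2 ^ n" by simp
    qed (use h in simp)
    moreover have "0 \<le> real j * h" using h by simp
    moreover have "c j = a + real j * h - h" by (simp add: c_def algebra_simps)
    ultimately have "a - L \<le> c j" "c j + 3 * h \<le> b + L"
      using h unfolding L_def distrib_right by linarith+
    then have "V \<le> \<gamma> ^ n * U"
      unfolding V_def U_def using h
      by (intro u_scale) (auto simp: L_def)
    then have "V powr \<kappa> \<le> (\<gamma> ^ n * U) powr \<kappa>"
      using V \<kappa> by (intro powr_mono2) auto
    have "Xj \<le> F powr p * V powr \<kappa>"
      unfolding Xj_def V_def using h by (intro X_le) auto
    also have "\<dots> \<le> F powr p * (\<gamma> ^ n * U) powr \<kappa>"
      using \<open>V powr \<kappa> \<le> (\<gamma> ^ n * U) powr \<kappa>\<close> by (intro mult_left_mono) auto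
    also have "\<dots> = M * (\<gamma> powr \<kappa>) ^ n"
      using \<gamma> by (simp add: M_def powr_mult powr_realpow[symmetric] powr_powr mult_ac)
    finally have XM: "Xj \<le> M * (\<gamma> powr \<kappa>) ^ n" .
    have "Xj powr (q / p) = Xj powr (q / p - 1) * Xj"
      using Xj by (cases "Xj = 0") (auto simp: powr_diff)
    also have "\<dots> \<le> (M * (\<gamma> powr \<kappa>) ^ n) powr (q / p - 1) * Xj"
      using XM Xj p p_less_q by (intro mult_right_mono powr_mono2) auto
    also have "\<dots> = (\<gamma> powr \<eta>) ^ n * M powr (q / p - 1) * Xj"
      using \<gamma> by (simp add: powr_mult powr_realpow[symmetric] powr_powr \<eta>_def mult_ac)
    finally have X1: "Xj powr (q / p) \<le> (\<gamma> powr \<eta>) ^ n * M powr (q / p - 1) * Xj" .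
    have "piece a b n j = A * 6 powr (1 - \<beta>) * (Xj powr (1 / p) * V powr (- (1 / q)))"
      by (simp add: piece_def Let_def Xj_def V_def c_def h_def L_def)
    also have "\<dots> powr q = (A * 6 powr (1 - \<beta>)) powr q * (Xj powr (1 / p * q) * V powr (- (1 / q) * q))"
      by (simp only: powr_mult powr_powr)
    also have "\<dots> = (A * 6 powr (1 - \<beta>)) powr q * (Xj powr (q / p) * (1 / V))"
      using V q_pos by (simp add: powr_minus_divide)
    finally have "piece a b n j powr q = (A * 6 powr (1 - \<beta>)) powr q * (Xj powr (q / p) * (1 / V))" .
    then have "piece a b n j powr q * u (a + real j * h) (a + (real j + 1) * h)
        = (A * 6 powr (1 - \<beta>)) powr q * (Xj powr (q / p) * (u (a + real j * h) (a + (real j + 1) * h) / V))"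
      by simp
    also have "\<dots> \<le> (A * 6 powr (1 - \<beta>)) powr q * (Xj powr (q / p) * 1)"
    proof (intro mult_left_mono)
      have "u (a + real j * h) (a + (real j + 1) * h) \<le> V"
        unfolding V_def using h by (intro u_mono) (auto simp: c_def algebra_simps)
      then show "u (a + real j * h) (a + (real j + 1) * h) / V \<le> 1" using V by simp
    qed auto
    also have "\<dots> \<le> (A * 6 powr (1 - \<beta>)) powr q * ((\<gamma> powr \<eta>) ^ n * M powr (q / p - 1) * Xj)"
      using X1 by (intro mult_left_mono) auto
    finally show ?thesis by (simp add: Xj_def mult_ac)
  qed
  have "(\<Sum>j<2 ^ n. ratio powr (- real n * q) * piece a b n j powr q *
      u (a + real j * ((b - a) / 2 ^ n)) (a + (real j + 1) * ((b - a) / 2 ^ n)))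
    = ratio powr (- real n * q) * (\<Sum>j<2 ^ n. piece a b n j powr q * u (a + real j * h) (a + (real j + 1) * h))"
    by (simp add: sum_distrib_left h_def L_def mult_ac)
  also have "\<dots> \<le> ratio powr (- real n * q) * (\<Sum>j<2 ^ n.
      (A * 6 powr (1 - \<beta>)) powr q * (\<gamma> powr \<eta>) ^ n * M powr (q / p - 1) * X (c j) (c j + 3 * h))"
    using piece by (intro mult_left_mono sum_mono) auto
  also have "\<dots> = ratio powr (- real n * q) * ((A * 6 powr (1 - \<beta>)) powr q * (\<gamma> powr \<eta>) ^ n * M powr (q / p - 1)
      * (\<Sum>j<2 ^ n. X (c j) (c j + 3 * h)))"
    by (simp only: sum_distrib_left)
  also have "\<dots> \<le> ratio powr (- real n * q) * ((A * 6 powr (1 - \<beta>)) powr q * (\<gamma> powr \<eta>) ^ n * M powr (q / p - 1)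
      * (3 * M))"
  proof (intro mult_left_mono)
    have "(\<Sum>j<2 ^ n. X (c j) (c j + 3 * h)) \<le> 3 * X (a - h) (a + (real (2 ^ n) + 1) * h)"
      unfolding c_def by (rule sum_X_le[OF h(1)])
    also have "X (a - h) (a + (real (2 ^ n) + 1) * h) \<le> X (a - L) (b + L)"
      using h L by (intro X_mono) (auto simp: L_def algebra_simps)
    also have "X (a - L) (b + L) \<le> M"
      unfolding M_def U_def L_def using assms by (intro X_le) auto
    finally show "(\<Sum>j<2 ^ n. X (c j) (c j + 3 * h)) \<le> 3 * M" by simp
  qed auto
  also have "\<dots> = 3 * (A * 6 powr (1 - \<beta>)) powr q * (M powr (q / p - 1) * M)
      * (ratio powr (- real n * q) * (\<gamma> powr \<eta>) ^ n)"
    by (simp only: mult_ac)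
  also have "M powr (q / p - 1) * M = M powr (q / p)"
    using M by (cases "M = 0") (auto simp: powr_diff)
  also have "\<dots> = F powr q * U powr (\<kappa> * q / p)"
    using p by (simp add: M_def powr_mult powr_powr)
  \<comment> \<open>The weight equals \<gamma>^(-n \<eta>/2) and so costs half of the gain.\<close>
  also have "ratio powr (- real n * q) * (\<gamma> powr \<eta>) ^ n = (\<gamma> powr (\<eta> / 2)) ^ n"
  proof -
    have "ratio powr (- real n * q) = (ratio powr q) powr (- real n)"
      by (simp add: powr_powr mult.commute)
    also have "\<dots> = \<gamma> powr (- real n * (\<eta> / 2))"
      by (simp add: ratio powr_powr mult.commute)
    moreover have "(\<gamma> powr \<eta>) ^ n = \<gamma> powr (real n * \<eta>)"
      using \<gamma> by (simp add: powr_realpow[symmetric] powr_powr mult.commute)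
    ultimately have "ratio powr (- real n * q) * (\<gamma> powr \<eta>) ^ n = \<gamma> powr (- real n * (\<eta> / 2) + real n * \<eta>)"
      by (simp only: powr_add)
    also have "- real n * (\<eta> / 2) + real n * \<eta> = \<eta> / 2 * real n" by simp
    also have "\<gamma> powr (\<eta> / 2 * real n) = (\<gamma> powr (\<eta> / 2)) ^ n"
      using \<gamma> by (simp add: powr_realpow[symmetric] powr_powr)
    finally show ?thesis .
  qed
  finally show ?thesis by (simp add: mult_ac)
qed

text \<open>Integration against w^q turns the indicators into masses of pieces;
  \<open>piece_sum_le\<close> then leaves a geometric series over the scales.\<close>

lemma inner_sum_integral:
  assumes "a < b"
  shows "(\<integral>\<^sup>+x. inner_sum a b x * ennreal (w x powr q) \<partial>lebesgue)
    \<le> ennreal (3 * (A * 6 powr (1 - \<beta>)) powr q / (1 - \<gamma> powr (\<eta> / 2)) * F powr q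
        * u (a - (b - a)) (b + (b - a)) powr (\<kappa> * q / p))"
proof -
  define I where "I n j = {a + real j * ((b - a) / 2 ^ n)..a + (real j + 1) * ((b - a) / 2 ^ n)}" for n j
  define B where "B = 3 * (A * 6 powr (1 - \<beta>)) powr q * F powr q * u (a - (b - a)) (b + (b - a)) powr (\<kappa> * q / p)"
  have B: "0 \<le> B" by (simp add: B_def)
  have \<eta>: "0 < \<eta>" using exponent_pos by (simp add: \<eta>_def)
  have "(\<integral>\<^sup>+x. inner_sum a b x * ennreal (w x powr q) \<partial>lebesgue)
    = (\<integral>\<^sup>+x. (\<Sum>n. \<Sum>j<2 ^ n. ennreal (ratio powr (- real n * q) * piece a b n j powr q) *
        (ennreal (w x powr q) * indicator (I n j) x)) \<partial>lebesgue)"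
    by (simp only: inner_sum_def I_def ennreal_suminf_cmult[symmetric] sum_distrib_left mult_ac)
  also have "\<dots> = (\<Sum>n. \<Sum>j<2 ^ n. ennreal (ratio powr (- real n * q) * piece a b n j powr q) *
        (\<integral>\<^sup>+x\<in>I n j. ennreal (w x powr q) \<partial>lebesgue))"
    by (subst nn_integral_suminf) (auto simp: nn_integral_sum nn_integral_cmult I_def)
  also have "\<dots> \<le> (\<Sum>n. ennreal (B * (\<gamma> powr (\<eta> / 2)) ^ n))"
  proof (intro suminf_le allI)
    fix n
    have I: "(\<integral>\<^sup>+x\<in>I n j. ennreal (w x powr q) \<partial>lebesgue)
        = ennreal (u (a + real j * ((b - a) / 2 ^ n)) (a + (real j + 1) * ((b - a) / 2 ^ n)))"
      and u0: "0 < u (a + real j * ((b - a) / 2 ^ n)) (a + (real j + 1) * ((b - a) / 2 ^ n))" for j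
    proof -
      have "a + real j * ((b - a) / 2 ^ n) < a + (real j + 1) * ((b - a) / 2 ^ n)"
        using assms by (intro add_strict_left_mono mult_strict_right_mono) auto
      then show "(\<integral>\<^sup>+x\<in>I n j. ennreal (w x powr q) \<partial>lebesgue)
          = ennreal (u (a + real j * ((b - a) / 2 ^ n)) (a + (real j + 1) * ((b - a) / 2 ^ n)))"
        and "0 < u (a + real j * ((b - a) / 2 ^ n)) (a + (real j + 1) * ((b - a) / 2 ^ n))"
        unfolding I_def by (auto intro: u_eq u_pos)
    qed
    have "(\<Sum>j<2 ^ n. ennreal (ratio powr (- real n * q) * piece a b n j powr q) *
        (\<integral>\<^sup>+x\<in>I n j. ennreal (w x powr q) \<partial>lebesgue))
      = ennreal (\<Sum>j<2 ^ n. ratio powr (- real n * q) * piece a b n j powr q *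
      u (a + real j * ((b - a) / 2 ^ n)) (a + (real j + 1) * ((b - a) / 2 ^ n)))"
      using u0 by (subst sum_ennreal[symmetric]) (auto simp: I less_imp_le ennreal_mult)
    also have "\<dots> \<le> ennreal (B * (\<gamma> powr (\<eta> / 2)) ^ n)"
      unfolding B_def using piece_sum_le[OF assms] by (intro ennreal_leI)
    finally show "(\<Sum>j<2 ^ n. ennreal (ratio powr (- real n * q) * piece a b n j powr q) *
        (\<integral>\<^sup>+x\<in>I n j. ennreal (w x powr q) \<partial>lebesgue)) \<le> ennreal (B * (\<gamma> powr (\<eta> / 2)) ^ n)" .
  qed auto
  also have "\<dots> = ennreal (B * (1 / (1 - \<gamma> powr (\<eta> / 2))))"
  proof (intro suminf_ennreal_eq sums_mult geometric_sums)
    show "norm (\<gamma> powr (\<eta> / 2)) < 1" using \<gamma> \<eta> powr_less_mono2[of "\<eta> / 2" \<gamma> 1] by auto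
  qed (use B in auto)
  finally show ?thesis by (simp add: B_def mult_ac)
qed

text \<open>The first summand belongs to distances up to \<open>b - a\<close> and includes the
  doubling constant of the triple, the second to larger distances; \<open>2 powr q\<close> comes
  from splitting the two. Neither \<open>g\<close> nor \<open>F\<close> enters, which makes the
  final bound uniform in \<open>f\<close>.\<close>

definition "frac_const =
  2 powr q * ((1 / (1 - ratio)) powr q * (3 * (A * 6 powr (1 - \<beta>)) powr q / (1 - \<gamma> powr (\<eta> / 2)))
      * ((A * 3 powr (1 - \<beta>)) powr q) powr (\<kappa> * q / p)
    + (A * 6 powr (1 - \<beta>) / (1 - \<gamma> powr (1 / q - \<kappa> / p))) powr q)"

lemma frac_const_nonneg: "0 \<le> frac_const"
proof -
  have "0 < \<eta>" using exponent_pos by (simp add: \<eta>_def)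
  then have "\<gamma> powr (\<eta> / 2) < 1"
    using \<gamma> powr_less_mono2[of "\<eta> / 2" \<gamma> 1] by auto
  then show ?thesis by (simp add: frac_const_def)
qed

text \<open>The fractional integral is split at distance \<open>b - a\<close>. The near part is
  controlled only after integration against w^q, the far part by a constant on
  \<open>[a, b]\<close>.\<close>

lemma frac_int_integral_le:
  assumes "a < b"
  shows "(\<integral>\<^sup>+x\<in>{a..b}. epowr (frac_int \<beta> g x) q * ennreal (w x powr q) \<partial>lebesgue)
    \<le> ennreal (frac_const * F powr q * u a b powr (\<kappa> * q / p))"
proof -
  define Ki where "Ki = (1 / (1 - ratio)) powr q"
  define Ji where "Ji = 3 * (A * 6 powr (1 - \<beta>)) powr q / (1 - \<gamma> powr (\<eta> / 2))"
  define Ko where "Ko = A * 6 powr (1 - \<beta>) / (1 - \<gamma> powr (1 / q - \<kappa> / p))"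
  define D3 where "D3 = (A * 3 powr (1 - \<beta>)) powr q"
  define G where "G = Ko * F * u a b powr (\<kappa> / p - 1 / q)"
  have \<eta>: "0 < \<eta>" using exponent_pos by (simp add: \<eta>_def)
  have less1: "\<gamma> powr (\<eta> / 2) < 1" "\<gamma> powr (1 / q - \<kappa> / p) < 1"
    using \<gamma> \<eta> powr_less_mono2[of "\<eta> / 2" \<gamma> 1] exponent_pos powr_less_mono2[of "1 / q - \<kappa> / p" \<gamma> 1] by auto
  have nonneg: "0 \<le> Ki" "0 \<le> Ji" "0 \<le> Ko" "0 \<le> D3" "0 \<le> G"
    using less1 A_ge_1 F by (auto simp: Ki_def Ji_def Ko_def D3_def G_def)
  have u0: "0 < u a b" by (rule u_pos[OF assms])
  have point: "epowr (frac_int \<beta> g x) q \<le> ennreal (2 powr q) * (ennreal Ki * inner_sum a b x + ennreal (G powr q))"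
    if x: "a \<le> x" "x \<le> b" for x
  proof -
    let ?k = "\<lambda>y. ennreal (\<bar>x - y\<bar> powr (\<beta> - 1) * g y)"
    let ?i = "\<integral>\<^sup>+y. ?k y * indicator {y. \<bar>x - y\<bar> \<le> b - a} y \<partial>lebesgue"
    let ?o = "\<integral>\<^sup>+y. ?k y * indicator {y. b - a < \<bar>x - y\<bar>} y \<partial>lebesgue"
    have "frac_int \<beta> g x = (\<integral>\<^sup>+y. ?k y * indicator {y. \<bar>x - y\<bar> \<le> b - a} y
        + ?k y * indicator {y. b - a < \<bar>x - y\<bar>} y \<partial>lebesgue)"
      unfolding frac_int_def by (intro nn_integral_cong) (auto split: split_indicator)
    also have "\<dots> = ?i + ?o"
      by (rule nn_integral_add) measurable
    finally have "epowr (frac_int \<beta> g x) q \<le> ennreal (2 powr q) * (epowr ?i q + epowr ?o q)"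
      using epowr_add_le[OF q_pos] by simp
    also have "epowr ?i q \<le> ennreal Ki * inner_sum a b x"
      unfolding Ki_def by (rule inner_le[OF x assms])
    also have "epowr ?o q \<le> epowr (ennreal G) q"
      unfolding G_def Ko_def by (rule epowr_mono[OF outer_le[OF x assms] q_pos])
    also have "\<dots> = ennreal (G powr q)"
      using nonneg q_pos by (intro epowr_ennreal)
    finally show ?thesis by (simp add: mult_left_mono add_mono)
  qed
  have "(\<integral>\<^sup>+x\<in>{a..b}. epowr (frac_int \<beta> g x) q * ennreal (w x powr q) \<partial>lebesgue)
    \<le> (\<integral>\<^sup>+x. ennreal (2 powr q * Ki) * (inner_sum a b x * ennreal (w x powr q))
        + ennreal (2 powr q * G powr q) * (ennreal (w x powr q) * indicator {a..b} x) \<partial>lebesgue)"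
  proof (intro nn_integral_mono)
    fix x
    show "epowr (frac_int \<beta> g x) q * ennreal (w x powr q) * indicator {a..b} x
      \<le> ennreal (2 powr q * Ki) * (inner_sum a b x * ennreal (w x powr q))
        + ennreal (2 powr q * G powr q) * (ennreal (w x powr q) * indicator {a..b} x)"
    proof (cases "x \<in> {a..b}")
      case True
      then have "epowr (frac_int \<beta> g x) q * ennreal (w x powr q)
          \<le> ennreal (2 powr q) * (ennreal Ki * inner_sum a b x + ennreal (G powr q)) * ennreal (w x powr q)"
        by (intro mult_right_mono point) auto
      also have "\<dots> = ennreal (2 powr q * Ki) * (inner_sum a b x * ennreal (w x powr q))
        + ennreal (2 powr q * G powr q) * ennreal (w x powr q)"
        using nonneg by (simp add: ennreal_mult distrib_left distrib_right mult_ac)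
      finally show ?thesis using True by simp
    qed simp
  qed
  also have "\<dots> = ennreal (2 powr q * Ki) * (\<integral>\<^sup>+x. inner_sum a b x * ennreal (w x powr q) \<partial>lebesgue)
        + ennreal (2 powr q * G powr q) * ennreal (u a b)"
    by (subst nn_integral_add) (auto simp: nn_integral_cmult u_eq[OF assms])
  also have "\<dots> \<le> ennreal (2 powr q * Ki) * ennreal (Ji * F powr q * (D3 * u a b) powr (\<kappa> * q / p))
        + ennreal (2 powr q * G powr q) * ennreal (u a b)"
  proof (intro add_right_mono mult_left_mono order_trans[OF inner_sum_integral[OF assms]] ennreal_leI)
    \<comment> \<open>\<open>inner_sum_integral\<close> produces the mass of the triple; doubling
      returns to \<open>u a b\<close>.\<close>
    have "(b + (b - a) - (a - (b - a))) / (b - a) = 3" using assms by (simp add: field_simps)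
    then have "u (a - (b - a)) (b + (b - a)) \<le> D3 * u a b"
      using u_doubling[of "a - (b - a)" a b "b + (b - a)"] assms by (simp only: D3_def)
    then have "u (a - (b - a)) (b + (b - a)) powr (\<kappa> * q / p) \<le> (D3 * u a b) powr (\<kappa> * q / p)"
      using assms \<kappa> q_pos p u_pos[of "a - (b - a)" "b + (b - a)"] by (intro powr_mono2) auto
    then show "3 * (A * 6 powr (1 - \<beta>)) powr q / (1 - \<gamma> powr (\<eta> / 2)) * F powr q
        * u (a - (b - a)) (b + (b - a)) powr (\<kappa> * q / p) \<le> Ji * F powr q * (D3 * u a b) powr (\<kappa> * q / p)"
      unfolding Ji_def[symmetric] using nonneg by (intro mult_left_mono) auto
  qed auto
  also have "\<dots> = ennreal (2 powr q * Ki * (Ji * F powr q * (D3 * u a b) powr (\<kappa> * q / p)) + 2 powr q * G powr q * u a b)"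
    using nonneg u0 by (simp add: ennreal_mult ennreal_plus)
  also have "2 powr q * Ki * (Ji * F powr q * (D3 * u a b) powr (\<kappa> * q / p)) + 2 powr q * G powr q * u a b
      = frac_const * F powr q * u a b powr (\<kappa> * q / p)"
  proof -
    \<comment> \<open>The q-th power of the constant \<open>G\<close> is multiplied by
      \<open>u a b\<close>, which accounts for the extra 1 in the exponent.\<close>
    have "(\<kappa> / p - 1 / q) * q + 1 = \<kappa> * q / p" using q_pos by (simp add: field_simps)
    then have "u a b powr ((\<kappa> / p - 1 / q) * q) * u a b = u a b powr (\<kappa> * q / p)"
      using u0 powr_add[of "u a b" "(\<kappa> / p - 1 / q) * q" 1] by simp
    then have G: "G powr q * u a b = Ko powr q * F powr q * u a b powr (\<kappa> * q / p)"
      using nonneg F by (simp add: G_def powr_mult powr_powr mult_ac)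
    have "2 powr q * Ki * (Ji * F powr q * (D3 * u a b) powr (\<kappa> * q / p)) + 2 powr q * G powr q * u a b
      = 2 powr q * Ki * (Ji * F powr q * (D3 powr (\<kappa> * q / p) * u a b powr (\<kappa> * q / p)))
        + 2 powr q * (G powr q * u a b)"
      using nonneg u0 by (simp add: powr_mult mult.assoc)
    also have "\<dots> = (2 powr q * (Ki * Ji * D3 powr (\<kappa> * q / p) + Ko powr q)) * F powr q * u a b powr (\<kappa> * q / p)"
      unfolding G by (simp add: algebra_simps)
    finally show ?thesis by (simp add: frac_const_def Ki_def Ji_def Ko_def D3_def)
  qed
  finally show ?thesis .
qed

end

section \<open>Real-valued masses from \<open>A_weight\<close>, and the transfer to Morrey
  norms\<close>

lemma weight_measurable:
  assumes "weight w" shows "w \<in> borel_measurable lebesgue"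
proof (rule borel_measurable_LIMSEQ_real)
  fix x :: real
  have "\<forall>\<^sub>F n in sequentially. \<bar>x\<bar> \<le> real n"
    using eventually_ge_at_top[of "nat \<lceil>\<bar>x\<bar>\<rceil>"] by eventually_elim linarith
  then have "\<forall>\<^sub>F n in sequentially. w x = indicator {- real n..real n} x *\<^sub>R w x"
    by eventually_elim (auto split: split_indicator)
  then show "(\<lambda>n. indicator {- real n..real n} x *\<^sub>R w x) \<longlonglongrightarrow> w x"
    by (rule Lim_transform_eventually[OF tendsto_const])
next
  show "(\<lambda>x. indicator {- real n..real n} x *\<^sub>R w x) \<in> borel_measurable lebesgue" for n
    using assms by (auto simp: weight_def set_integrable_def)
qed

text \<open>Local integrability of w^(-p') forces \<open>0 < w\<close> almost everywhere, hence both
  masses are positive, and finiteness of the supremum then forces the mass of w^q to be finite. So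
  all quantities become real numbers.\<close>

lemma A_weight_Apq_weight:
  assumes "A_weight p q w" "1 < p" "0 < \<beta>" "p < 1 / \<beta>" "1 / q = 1 / p - \<beta>"
  obtains A u s where "Apq_weight p q \<beta> A w u s"
proof -
  define P where "P = p / (p - 1)"
  have P: "0 < P" "1 / P = 1 - 1 / p" using assms(2) by (auto simp: P_def field_simps)
  have "\<beta> < 1 / p" using assms(2-4) by (simp add: field_simps)
  then have "0 < 1 / q" using assms(5) by simp
  then have q: "0 < q" by simp
  define Iu where "Iu a b = (\<integral>\<^sup>+x\<in>{a..b}. ennreal (w x powr q) \<partial>lebesgue)" for a b
  define Is where "Is a b = (\<integral>\<^sup>+x\<in>{a..b}. epowr (ennreal (w x)) (- P) \<partial>lebesgue)" for a b
  define S where "S = (SUP (a, b) \<in> {(a, b). a < b}.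
           epowr (Iu a b / ennreal (b - a)) (1 / q) * epowr (Is a b / ennreal (b - a)) (1 / P))"
  have w0: "0 \<le> w x" for x using assms(1) by (auto simp: A_weight_def weight_def Let_def)
  have [measurable]: "w \<in> borel_measurable lebesgue"
    using assms(1) by (intro weight_measurable) (simp add: A_weight_def Let_def)
  have Is_fin: "Is a b < \<infinity>" for a b
    using assms(1) by (auto simp: A_weight_def Let_def Is_def P_def)
  have S_fin: "S < \<infinity>"
    using assms(1) by (simp add: A_weight_def Let_def S_def Iu_def Is_def P_def)
  have nonnull: "(\<integral>\<^sup>+x\<in>{a..b}. h x \<partial>lebesgue) \<noteq> 0"
    if "a < b" "AE x in lebesgue. h x \<noteq> 0" and [measurable]: "h \<in> borel_measurable lebesgue"
    for a b :: real and h
  proof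
    assume "(\<integral>\<^sup>+x\<in>{a..b}. h x \<partial>lebesgue) = 0"
    then have "AE x in lebesgue. h x * indicator {a..b} x = 0"
      by (subst (asm) nn_integral_0_iff_AE) auto
    with that(2) have "AE x in lebesgue. x \<notin> {a..b}"
      by eventually_elim (auto split: split_indicator_asm)
    then have "emeasure lebesgue {x \<in> space lebesgue. x \<in> {a..b}} = 0"
      by (rule emeasure_eq_0_AE)
    also have "{x \<in> space lebesgue. x \<in> {a..b}} = {a..b}" by auto
    finally show False using that(1) by simp
  qed
  have pos: "AE x in lebesgue. 0 < w x"
  proof -
    \<comment> \<open>Exhaustion by bounded intervals: a finite integral makes the integrand finite
      almost everywhere, whereas a negative \<open>epowr\<close> of 0 is
      \<open>\<infinity>\<close>.\<close>
    have "AE x in lebesgue. \<forall>n. epowr (ennreal (w x)) (- P) * indicator {- real n..real n} x \<noteq> \<infinity>"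
    proof (intro AE_all_countable[THEN iffD2] allI)
      fix n show "AE x in lebesgue. epowr (ennreal (w x)) (- P) * indicator {- real n..real n} x \<noteq> \<infinity>"
        using Is_fin[of "- real n" "real n"] by (intro nn_integral_noteq_infinite) (auto simp: Is_def)
    qed
    then show ?thesis
    proof eventually_elim
      case (elim x)
      obtain n :: nat where "\<bar>x\<bar> \<le> real n" using real_arch_simple by blast
      then have "epowr (ennreal (w x)) (- P) \<noteq> \<infinity>"
        using elim[rule_format, of n] by (auto simp: abs_le_iff split: split_indicator_asm)
      then have "w x \<noteq> 0" using P by (auto simp: epowr_def)
      then show ?case using w0[of x] by simp
    qed
  qed
  have Is_pos: "Is a b \<noteq> 0" if "a < b" for a b
    unfolding Is_def
    by (rule nonnull[OF that]) (use pos in \<open>auto elim!: eventually_mono simp: epowr_ennreal_pos ennreal_eq_0_iff\<close>)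
  have Iu_pos: "Iu a b \<noteq> 0" if "a < b" for a b
    unfolding Iu_def
    by (rule nonnull[OF that]) (use pos in \<open>auto elim!: eventually_mono simp: ennreal_eq_0_iff\<close>)
  have S_ge: "epowr (Iu a b / ennreal (b - a)) (1 / q) * epowr (Is a b / ennreal (b - a)) (1 / P) \<le> S"
    if "a < b" for a b
    unfolding S_def using that by (intro SUP_upper2[of "(a, b)"]) auto
  define s where "s a b = enn2real (Is a b)" for a b
  have s: "Is a b = ennreal (s a b)" for a b
    using Is_fin[of a b] by (simp add: s_def less_top)
  have s_pos: "0 < s a b" if "a < b" for a b
    using Is_pos[OF that] s[of a b] by (cases "0 < s a b") (auto simp: ennreal_neg)
  have Iu_fin: "Iu a b < \<infinity>" if "a < b" for a b
  proof (rule ccontr)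
    assume "\<not> Iu a b < \<infinity>"
    \<comment> \<open>An infinite factor times a nonzero one would make the supremum
      infinite.\<close>
    then have "epowr (Iu a b / ennreal (b - a)) (1 / q) = \<infinity>"
      using q by (simp add: less_top[symmetric] epowr_def ennreal_top_divide)
    moreover have "epowr (Is a b / ennreal (b - a)) (1 / P) \<noteq> 0"
      using s_pos[OF that] that P by (simp add: s divide_ennreal epowr_ennreal_pos ennreal_eq_0_iff)
    ultimately show False using S_ge[OF that] S_fin by (simp add: ennreal_top_mult top_unique)
  qed
  define u where "u a b = enn2real (Iu a b)" for a b
  have u: "Iu a b = ennreal (u a b)" if "a < b" for a b
    using Iu_fin[OF that] by (simp add: u_def less_top)
  have u_pos: "0 < u a b" if "a < b" for a b
    using Iu_pos[OF that] u[OF that] by (cases "0 < u a b") (auto simp: ennreal_neg)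
  obtain A where A: "0 \<le> A" "S = ennreal A" using S_fin by (cases S) auto
  have "Apq_weight p q \<beta> A w u s"
  proof
    fix a b :: real assume ab: "a < b"
    show "(\<integral>\<^sup>+x\<in>{a..b}. ennreal (w x powr q) \<partial>lebesgue) = ennreal (u a b)"
      using u[OF ab] by (simp add: Iu_def)
    \<comment> \<open>\<open>powr\<close> and \<open>epowr\<close> disagree at zeros of
      \<open>w\<close>, which form a null set.\<close>
    have "AE x in lebesgue. ennreal (w x powr - (p / (p - 1))) * indicator {a..b} x
        = epowr (ennreal (w x)) (- P) * indicator {a..b} x"
      using pos by eventually_elim (simp add: epowr_ennreal_pos P_def)
    then have "(\<integral>\<^sup>+x\<in>{a..b}. ennreal (w x powr - (p / (p - 1))) \<partial>lebesgue) = Is a b"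
      unfolding Is_def by (rule nn_integral_cong_AE)
    then show "(\<integral>\<^sup>+x\<in>{a..b}. ennreal (w x powr - (p / (p - 1))) \<partial>lebesgue) = ennreal (s a b)"
      by (simp add: s)
    show "0 < u a b" "0 < s a b" using u_pos s_pos ab by auto
    have "epowr (ennreal (u a b) / ennreal (b - a)) (1 / q) * epowr (ennreal (s a b) / ennreal (b - a)) (1 / P) \<le> ennreal A"
      using S_ge[OF ab] by (simp add: u[OF ab] s A)
    then have "ennreal ((u a b / (b - a)) powr (1 / q) * (s a b / (b - a)) powr (1 / P)) \<le> ennreal A"
      using ab u_pos[OF ab] s_pos[OF ab] by (simp add: divide_ennreal epowr_ennreal_pos ennreal_mult)
    then have "(u a b / (b - a)) powr (1 / q) * (s a b / (b - a)) powr (1 / P) \<le> A"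
      using A by (simp add: ennreal_le_iff)
    then have "u a b powr (1 / q) * s a b powr (1 / P) / ((b - a) powr (1 / q) * (b - a) powr (1 / P)) \<le> A"
      using ab u_pos[OF ab] s_pos[OF ab] by (simp add: powr_divide)
    \<comment> \<open>The normalising lengths combine because 1/q + 1/P = 1/q + 1 - 1/p = 1 -
      \<beta>.\<close>
    also have "(b - a) powr (1 / q) * (b - a) powr (1 / P) = (b - a) powr (1 - \<beta>)"
      unfolding powr_add[symmetric] using P assms(5) by simp
    finally show "u a b powr (1 / q) * s a b powr (1 - 1 / p) \<le> A * (b - a) powr (1 - \<beta>)"
      using ab P by (simp add: pos_divide_le_eq)
  qed (use assms w0 pos in auto)
  then show ?thesis by (rule that)
qed

lemma sigma_finite_lebesgue: "sigma_finite_measure (lebesgue :: real measure)"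
proof
  show "\<exists>A. countable A \<and> A \<subseteq> sets (lebesgue :: real measure) \<and> \<Union> A = space lebesgue
      \<and> (\<forall>a\<in>A. emeasure lebesgue a \<noteq> \<infinity>)"
  proof (intro exI[of _ "range (\<lambda>n. {- real n..real n})"] conjI)
    have "x \<in> (\<Union>n. {- real n..real n})" for x :: real
      using real_arch_simple[of "\<bar>x\<bar>"] by (auto simp: abs_le_iff minus_le_iff)
    then show "(\<Union>n. {- real n..real n}) = space lebesgue" by auto
  qed auto
qed

lemma measurable_frac_int [measurable]:
  assumes [measurable]: "g \<in> borel_measurable lebesgue"
  shows "frac_int \<beta> g \<in> borel_measurable lebesgue"
proof -
  interpret L: sigma_finite_measure "lebesgue :: real measure" by (rule sigma_finite_lebesgue)
  show ?thesis unfolding frac_int_def by measurable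
qed

text \<open>Measurability and pointwise domination by the fractional integral suffice for any
  operator \<open>U\<close>, so oscillation and variation can be treated alike. Membership of
  \<open>f\<close> in the Morrey space supplies the instance of \<open>Apq_morrey\<close>, with the
  norm of \<open>f\<close> as \<open>F\<close>.\<close>

lemma bounded_operator_of_frac_int:
  assumes "Apq_weight p q \<beta> A w u s" and \<kappa>: "0 < \<kappa>" "\<kappa> < p / q" and C: "0 \<le> C"
    and op: "\<And>f F. f \<in> borel_measurable lebesgue \<Longrightarrow>
      Apq_morrey p q \<beta> A w u s \<kappa> F (\<lambda>y. norm (f y)) \<Longrightarrow>
      U f \<in> borel_measurable lebesgue \<and> (\<forall>x. U f x \<le> ennreal C * frac_int \<beta> (\<lambda>y. norm (f y)) x)"
  shows "bounded_operator U
           (morrey_space p \<kappa> (\<lambda>x. w x powr p) (\<lambda>x. w x powr q))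
           (morrey_norm p \<kappa> (\<lambda>x. w x powr p) (\<lambda>x. w x powr q))
           (morrey_space q (\<kappa> * q / p) (\<lambda>x. w x powr q) (\<lambda>x. w x powr q))
           (morrey_norm q (\<kappa> * q / p) (\<lambda>x. w x powr q) (\<lambda>x. w x powr q))"
proof -
  interpret Apq_weight p q \<beta> A w u s by fact
  define Kf where "Kf = Apq_morrey.frac_const p q \<beta> A \<kappa>"
  \<comment> \<open>The summand 1 guarantees a positive constant.\<close>
  define B where "B = C * Kf powr (1 / q) + 1"
  have "0 < B" using C by (simp add: B_def add_nonneg_pos)
  moreover have "U f \<in> morrey_space q (\<kappa> * q / p) (\<lambda>x. w x powr q) (\<lambda>x. w x powr q)
      \<and> morrey_norm q (\<kappa> * q / p) (\<lambda>x. w x powr q) (\<lambda>x. w x powr q) (U f)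
        \<le> ennreal B * morrey_norm p \<kappa> (\<lambda>x. w x powr p) (\<lambda>x. w x powr q) (\<lambda>x. ennreal (norm (f x)))"
    if f [measurable]: "f \<in> borel_measurable lebesgue"
      and mem: "(\<lambda>x. ennreal (norm (f x))) \<in> morrey_space p \<kappa> (\<lambda>x. w x powr p) (\<lambda>x. w x powr q)" for f
  proof -
    define g where "g y = norm (f y)" for y
    have [measurable]: "g \<in> borel_measurable lebesgue" unfolding g_def by measurable
    define N where "N = morrey_norm p \<kappa> (\<lambda>x. w x powr p) (\<lambda>x. w x powr q) (\<lambda>x. ennreal (norm (f x)))"
    obtain F where F: "0 \<le> F" "N = ennreal F"
      using mem by (cases N) (auto simp: morrey_space_def N_def)
    have "(\<integral>\<^sup>+x\<in>{a..b}. ennreal ((g x * w x) powr p) \<partial>lebesgue) \<le> ennreal (F powr p * u a b powr \<kappa>)"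
      if ab: "a < b" for a b
    proof -
      define I where "I = (\<integral>\<^sup>+x\<in>{a..b}. ennreal ((g x * w x) powr p) \<partial>lebesgue)"
      have eq: "(\<integral>\<^sup>+x\<in>{a..b}. epowr (ennreal (norm (f x))) p * ennreal (w x powr p) \<partial>lebesgue) = I"
        unfolding I_def g_def using p w_nonneg
        by (intro nn_integral_cong) (simp add: epowr_ennreal powr_mult ennreal_mult)
      have "epowr (\<integral>\<^sup>+x\<in>{a..b}. ennreal (w x powr q) \<partial>lebesgue) (- \<kappa> / p) *
        epowr (\<integral>\<^sup>+x\<in>{a..b}. epowr (ennreal (norm (f x))) p * ennreal (w x powr p) \<partial>lebesgue) (1 / p) \<le> N"
        unfolding N_def morrey_norm_def using ab by (intro SUP_upper2[of "(a, b)"]) auto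
      then have "ennreal (u a b powr (- \<kappa> / p)) * epowr I (1 / p) \<le> ennreal F"
        unfolding eq u_eq[OF ab] F using u_pos[OF ab] by (simp add: epowr_ennreal_pos)
      then have "ennreal (u a b powr (\<kappa> / p)) * (ennreal (u a b powr (- \<kappa> / p)) * epowr I (1 / p))
          \<le> ennreal (u a b powr (\<kappa> / p)) * ennreal F"
        by (rule mult_left_mono) simp
      moreover have "ennreal (u a b powr (\<kappa> / p)) * ennreal (u a b powr (- \<kappa> / p)) = 1"
        using u_pos[OF ab] by (simp add: powr_minus flip: ennreal_mult)
      ultimately have "epowr I (1 / p) \<le> ennreal (u a b powr (\<kappa> / p) * F)"
        using F by (simp add: mult.assoc[symmetric] ennreal_mult)
      then have "epowr (epowr I (1 / p)) p \<le> epowr (ennreal (u a b powr (\<kappa> / p) * F)) p"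
        using p by (intro epowr_mono) auto
      also have "\<dots> = ennreal (F powr p * u a b powr \<kappa>)"
        using p F by (simp add: epowr_ennreal powr_mult powr_powr mult.commute)
      finally show ?thesis using p by (simp add: epowr_epowr I_def)
    qed
    then have M: "Apq_morrey p q \<beta> A w u s \<kappa> F (\<lambda>y. norm (f y))"
      unfolding g_def by unfold_locales (use \<kappa> F in auto)
    interpret M: Apq_morrey p q \<beta> A w u s \<kappa> F "\<lambda>y. norm (f y)" by (rule M)
    have Uf [measurable]: "U f \<in> borel_measurable lebesgue"
      and Uf_le: "\<And>x. U f x \<le> ennreal C * frac_int \<beta> g x"
      using op[OF f M] by (auto simp: g_def[abs_def])
    have Kf: "0 \<le> Kf" using M.frac_const_nonneg by (simp add: Kf_def)
    have int: "(\<integral>\<^sup>+x\<in>{a..b}. epowr (U f x) q * ennreal (w x powr q) \<partial>lebesgue)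
        \<le> ennreal (C powr q * (Kf * F powr q * u a b powr (\<kappa> * q / p)))" if ab: "a < b" for a b
    proof -
      have "(\<integral>\<^sup>+x\<in>{a..b}. epowr (U f x) q * ennreal (w x powr q) \<partial>lebesgue)
         \<le> (\<integral>\<^sup>+x. ennreal (C powr q) * (epowr (frac_int \<beta> g x) q * ennreal (w x powr q) * indicator {a..b} x) \<partial>lebesgue)"
      proof (intro nn_integral_mono)
        fix x
        have "epowr (U f x) q \<le> epowr (ennreal C * frac_int \<beta> g x) q"
          using Uf_le q_pos by (rule epowr_mono)
        also have "\<dots> = ennreal (C powr q) * epowr (frac_int \<beta> g x) q"
          using C q_pos by (simp add: epowr_mult epowr_ennreal)
        finally have "epowr (U f x) q * (ennreal (w x powr q) * indicator {a..b} x)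
            \<le> ennreal (C powr q) * epowr (frac_int \<beta> g x) q * (ennreal (w x powr q) * indicator {a..b} x)"
          by (intro mult_right_mono) auto
        then show "epowr (U f x) q * ennreal (w x powr q) * indicator {a..b} x
            \<le> ennreal (C powr q) * (epowr (frac_int \<beta> g x) q * ennreal (w x powr q) * indicator {a..b} x)"
          by (simp add: mult_ac)
      qed
      also have "\<dots> = ennreal (C powr q) * (\<integral>\<^sup>+x\<in>{a..b}. epowr (frac_int \<beta> g x) q * ennreal (w x powr q) \<partial>lebesgue)"
        by (rule nn_integral_cmult) measurable
      also have "\<dots> \<le> ennreal (C powr q) * ennreal (Kf * F powr q * u a b powr (\<kappa> * q / p))"
        unfolding Kf_def g_def by (intro mult_left_mono M.frac_int_integral_le ab) auto
      finally show ?thesis using Kf by (simp add: ennreal_mult)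
    qed
    have norm_le: "morrey_norm q (\<kappa> * q / p) (\<lambda>x. w x powr q) (\<lambda>x. w x powr q) (U f) \<le> ennreal B * N"
      unfolding morrey_norm_def
    proof (intro SUP_least, clarify)
      fix a b :: real assume ab: "a < b"
      have "epowr (\<integral>\<^sup>+x\<in>{a..b}. ennreal (w x powr q) \<partial>lebesgue) (- (\<kappa> * q / p) / q)
          = ennreal (u a b powr (- (\<kappa> / p)))"
        using u_pos[OF ab] q_pos by (simp add: u_eq[OF ab] epowr_ennreal_pos)
      moreover have "epowr (\<integral>\<^sup>+x\<in>{a..b}. epowr (U f x) q * ennreal (w x powr q) \<partial>lebesgue) (1 / q)
          \<le> epowr (ennreal (C powr q * (Kf * F powr q * u a b powr (\<kappa> * q / p)))) (1 / q)"
        using q_pos by (intro epowr_mono int ab) auto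
      moreover have "epowr (ennreal (C powr q * (Kf * F powr q * u a b powr (\<kappa> * q / p)))) (1 / q)
          = ennreal (C * Kf powr (1 / q) * F * u a b powr (\<kappa> / p))"
        using C Kf F q_pos p by (simp add: epowr_ennreal powr_mult powr_powr)
      ultimately have "epowr (\<integral>\<^sup>+x\<in>{a..b}. ennreal (w x powr q) \<partial>lebesgue) (- (\<kappa> * q / p) / q)
          * epowr (\<integral>\<^sup>+x\<in>{a..b}. epowr (U f x) q * ennreal (w x powr q) \<partial>lebesgue) (1 / q)
        \<le> ennreal (u a b powr (- (\<kappa> / p))) * ennreal (C * Kf powr (1 / q) * F * u a b powr (\<kappa> / p))"
        by (simp add: mult_left_mono)
      also have "\<dots> = ennreal (C * Kf powr (1 / q) * F)"
        using u_pos[OF ab] C F Kf by (simp add: powr_minus field_simps flip: ennreal_mult)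
      also have "\<dots> \<le> ennreal (B * F)"
        unfolding B_def using F by (intro ennreal_leI mult_right_mono) auto
      also have "\<dots> = ennreal B * N"
        using F \<open>0 < B\<close> by (simp add: ennreal_mult)
      finally show "epowr (\<integral>\<^sup>+x\<in>{a..b}. ennreal (w x powr q) \<partial>lebesgue) (- (\<kappa> * q / p) / q)
          * epowr (\<integral>\<^sup>+x\<in>{a..b}. epowr (U f x) q * ennreal (w x powr q) \<partial>lebesgue) (1 / q) \<le> ennreal B * N" .
    qed
    have "(\<integral>\<^sup>+x\<in>{a..b}. epowr (U f x) q * ennreal (w x powr q) \<partial>lebesgue) < \<infinity>" for a b
    proof -
      have "(\<integral>\<^sup>+x\<in>{a..b}. epowr (U f x) q * ennreal (w x powr q) \<partial>lebesgue)
          \<le> (\<integral>\<^sup>+x\<in>{a..max b (a + 1)}. epowr (U f x) q * ennreal (w x powr q) \<partial>lebesgue)"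
        by (rule nn_integral_Icc_mono) auto
      \<comment> \<open>The enlarged interval is nondegenerate, so \<open>int\<close> applies even
        if \<open>b \<le> a\<close>.\<close>
      also have "\<dots> < \<infinity>"
        using int[of a "max b (a + 1)"] by (rule le_less_trans) auto
      finally show ?thesis .
    qed
    moreover have "ennreal B * N < \<infinity>" using F by (simp add: ennreal_mult_less_top)
    ultimately show ?thesis
      using norm_le unfolding N_def[symmetric] morrey_space_def by auto
  qed
  ultimately show ?thesis unfolding bounded_operator_def by blast
qed

subsection \<open>Truncated integrals\<close>

lemma nderiv_continuous:
  assumes "times_differentiable m b" "nderiv m b \<in> lipschitz_space \<beta>" "0 < \<beta>" "k \<le> m"
  shows "continuous_on UNIV (nderiv k b)"
proof (cases "k = m")
  case True
  then show ?thesis using continuous_lipschitz_space assms by blast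
next
  case False
  then have "\<And>x. nderiv k b differentiable (at x)"
    using assms by (auto simp: times_differentiable_def)
  then show ?thesis
    by (intro continuous_at_imp_continuous_on ballI differentiable_imp_continuous_within)
qed

lemma measurable_taylor_rem:
  assumes "\<And>k. k \<le> m \<Longrightarrow> continuous_on UNIV (nderiv k b)"
  shows "(\<lambda>z. taylor_rem m b (fst z) (snd z)) \<in> borel_measurable (borel \<Otimes>\<^sub>M borel)"
proof -
  have nd: "nderiv k b \<in> borel_measurable borel" if "k \<le> m" for k
    using assms[OF that] by (rule borel_measurable_continuous_onI)
  have [measurable]: "(\<lambda>z. nderiv k b (snd z)) \<in> borel_measurable (borel \<Otimes>\<^sub>M borel)" if "k \<le> m" for k
    by (rule measurable_compose[OF measurable_snd nd[OF that]])
  have "b = nderiv 0 b" by (simp add: nderiv_def)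
  then have [measurable]: "b \<in> borel_measurable borel" using nd[of 0] by simp
  show ?thesis unfolding taylor_rem_def by measurable
qed

text \<open>Continuity off the diagonal gives Borel measurability on an open set, and the truncation
  at \<open>\<epsilon>\<close> only sees that set.\<close>

lemma measurable_kernel:
  fixes K :: "real \<Rightarrow> real \<Rightarrow> complex"
  assumes "continuous_on {(x, y). x \<noteq> y} (\<lambda>(x, y). K x y)" "0 < \<epsilon>"
  shows "(\<lambda>z. indicator {z. \<epsilon> < \<bar>fst z - snd z\<bar>} z *\<^sub>R K (fst z) (snd z)) \<in> borel_measurable (borel \<Otimes>\<^sub>M borel)"
proof -
  have op: "open {(x :: real, y). x \<noteq> y}"
    unfolding case_prod_beta by (intro open_Collect_neq continuous_intros)
  have "(\<lambda>z. indicator {(x, y). x \<noteq> y} z *\<^sub>R (case z of (x, y) \<Rightarrow> K x y)) \<in> borel_measurable borel"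
    using op assms(1) by (intro borel_measurable_continuous_on_indicator) auto
  then have [measurable]: "(\<lambda>z. indicator {(x, y). x \<noteq> y} z *\<^sub>R (case z of (x, y) \<Rightarrow> K x y))
      \<in> borel_measurable (borel \<Otimes>\<^sub>M borel)"
    by (simp add: borel_prod)
  have "(\<lambda>z. indicator {z. \<epsilon> < \<bar>fst z - snd z\<bar>} z *\<^sub>R
      (indicator {(x, y). x \<noteq> y} z *\<^sub>R (case z of (x, y) \<Rightarrow> K x y))) \<in> borel_measurable (borel \<Otimes>\<^sub>M borel)"
    by measurable
  also have "(\<lambda>z. indicator {z. \<epsilon> < \<bar>fst z - snd z\<bar>} z *\<^sub>R
      (indicator {(x, y). x \<noteq> y} z *\<^sub>R (case z of (x, y) \<Rightarrow> K x y)))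
    = (\<lambda>z. indicator {z. \<epsilon> < \<bar>fst z - snd z\<bar>} z *\<^sub>R K (fst z) (snd z))"
    using assms(2) by (auto simp: fun_eq_iff split: split_indicator)
  finally show ?thesis .
qed

text \<open>\<open>finite_tail\<close> makes every truncated integral absolutely convergent, at
  every point \<open>x\<close>.\<close>

locale truncated_kernel =
  fixes k :: "real \<Rightarrow> real \<Rightarrow> complex" and f :: "real \<Rightarrow> complex"
  assumes kernel_measurable: "\<And>\<epsilon>. 0 < \<epsilon> \<Longrightarrow>
      (\<lambda>z. indicator {z. \<epsilon> < \<bar>fst z - snd z\<bar>} z *\<^sub>R k (fst z) (snd z)) \<in> borel_measurable (borel \<Otimes>\<^sub>M borel)"
    and f_measurable [measurable]: "f \<in> borel_measurable lebesgue"
    and finite_tail: "\<And>\<epsilon> x. 0 < \<epsilon> \<Longrightarrow>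
      (\<integral>\<^sup>+y. ennreal (norm (k x y * f y)) * indicator {y. \<epsilon> < \<bar>x - y\<bar>} y \<partial>lebesgue) < \<infinity>"
begin

definition "T \<epsilon> x = (LINT y:{y. \<bar>x - y\<bar> > \<epsilon>}|lebesgue. k x y * f y)"

text \<open>The majorant to be used in \<open>oscillation_le\<close> and
  \<open>variation_le\<close>.\<close>

definition "H \<epsilon> x = (LINT y:{y. \<bar>x - y\<bar> > \<epsilon>}|lebesgue. norm (k x y * f y))"

lemma measurable_pair:
  assumes "0 < \<epsilon>"
  shows "(\<lambda>z. indicator {y. \<epsilon> < \<bar>fst z - y\<bar>} (snd z) *\<^sub>R (k (fst z) (snd z) * f (snd z)))
    \<in> borel_measurable (lebesgue \<Otimes>\<^sub>M lebesgue)"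
proof -
  \<comment> \<open>The kernel is Borel measurable and \<open>f\<close> Lebesgue measurable, so the
    kernel is transported to the product of the Lebesgue spaces.\<close>
  have "(\<lambda>z. (fst z, snd z)) \<in> lebesgue \<Otimes>\<^sub>M lebesgue \<rightarrow>\<^sub>M (borel :: real measure) \<Otimes>\<^sub>M (borel :: real measure)"
    by (intro measurable_Pair measurable_compose[OF measurable_fst measurable_ident_lebesgue]
        measurable_compose[OF measurable_snd measurable_ident_lebesgue])
  from measurable_compose[OF this kernel_measurable[OF assms]]
  have [measurable]: "(\<lambda>z. indicator {z. \<epsilon> < \<bar>fst z - snd z\<bar>} z *\<^sub>R k (fst z) (snd z))
      \<in> borel_measurable (lebesgue \<Otimes>\<^sub>M lebesgue)" by simp
  have "(\<lambda>z. (indicator {z. \<epsilon> < \<bar>fst z - snd z\<bar>} z *\<^sub>R k (fst z) (snd z)) * f (snd z))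
      \<in> borel_measurable (lebesgue \<Otimes>\<^sub>M lebesgue)" by measurable
  also have "(\<lambda>z. (indicator {z. \<epsilon> < \<bar>fst z - snd z\<bar>} z *\<^sub>R k (fst z) (snd z)) * f (snd z))
      = (\<lambda>z. indicator {y. \<epsilon> < \<bar>fst z - y\<bar>} (snd z) *\<^sub>R (k (fst z) (snd z) * f (snd z)))"
    by (auto simp: fun_eq_iff split: split_indicator)
  finally show ?thesis .
qed

lemma measurable_T:
  assumes "0 < \<epsilon>" shows "T \<epsilon> \<in> borel_measurable lebesgue"
proof -
  interpret L: sigma_finite_measure "lebesgue :: real measure" by (rule sigma_finite_lebesgue)
  show ?thesis
    unfolding T_def[abs_def] set_lebesgue_integral_def
    by (rule L.borel_measurable_lebesgue_integral)
      (use measurable_pair[OF assms] in \<open>simp add: case_prod_beta\<close>)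
qed

lemma measurable_section:
  assumes "0 < \<epsilon>"
  shows "(\<lambda>y. indicator {y. \<epsilon> < \<bar>x - y\<bar>} y *\<^sub>R (k x y * f y)) \<in> borel_measurable lebesgue"
proof -
  have "(\<lambda>y. (x, y)) \<in> lebesgue \<rightarrow>\<^sub>M lebesgue \<Otimes>\<^sub>M lebesgue"
    by (rule measurable_Pair1') simp
  from measurable_compose[OF this measurable_pair[OF assms]] show ?thesis by simp
qed

lemma integrable_section:
  assumes "0 < \<epsilon>"
  shows "integrable lebesgue (\<lambda>y. indicator {y. \<epsilon> < \<bar>x - y\<bar>} y *\<^sub>R (k x y * f y))"
proof (rule integrableI_bounded[OF measurable_section[OF assms]])
  have "(\<integral>\<^sup>+y. ennreal (norm (indicator {y. \<epsilon> < \<bar>x - y\<bar>} y *\<^sub>R (k x y * f y))) \<partial>lebesgue)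
    = (\<integral>\<^sup>+y. ennreal (norm (k x y * f y)) * indicator {y. \<epsilon> < \<bar>x - y\<bar>} y \<partial>lebesgue)"
    by (intro nn_integral_cong) (auto split: split_indicator)
  then show "(\<integral>\<^sup>+y. ennreal (norm (indicator {y. \<epsilon> < \<bar>x - y\<bar>} y *\<^sub>R (k x y * f y))) \<partial>lebesgue) < \<infinity>"
    using finite_tail[OF assms, of x] by simp
qed

lemma integrable_norm_section:
  assumes "0 < \<epsilon>"
  shows "integrable lebesgue (\<lambda>y. indicator {y. \<epsilon> < \<bar>x - y\<bar>} y *\<^sub>R norm (k x y * f y))"
proof -
  have "(\<lambda>y. indicator {y. \<epsilon> < \<bar>x - y\<bar>} y *\<^sub>R norm (k x y * f y))
     = (\<lambda>y. norm (indicator {y. \<epsilon> < \<bar>x - y\<bar>} y *\<^sub>R (k x y * f y)))"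
    by (auto simp: fun_eq_iff split: split_indicator)
  then show ?thesis using integrable_norm[OF integrable_section[OF assms, of x]] by simp
qed

lemma H_nonneg: "0 \<le> H \<epsilon> x"
  unfolding H_def set_lebesgue_integral_def by (intro integral_nonneg_AE) auto

lemma H_eq:
  assumes "0 < \<epsilon>"
  shows "ennreal (H \<epsilon> x) = (\<integral>\<^sup>+y. ennreal (norm (k x y * f y)) * indicator {y. \<epsilon> < \<bar>x - y\<bar>} y \<partial>lebesgue)"
proof -
  have "ennreal (H \<epsilon> x) = (\<integral>\<^sup>+y. ennreal (indicator {y. \<epsilon> < \<bar>x - y\<bar>} y *\<^sub>R norm (k x y * f y)) \<partial>lebesgue)"
    unfolding H_def set_lebesgue_integral_def
    by (rule nn_integral_eq_integral[OF integrable_norm_section[OF assms], symmetric]) auto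
  also have "\<dots> = (\<integral>\<^sup>+y. ennreal (norm (k x y * f y)) * indicator {y. \<epsilon> < \<bar>x - y\<bar>} y \<partial>lebesgue)"
    by (intro nn_integral_cong) (auto split: split_indicator)
  finally show ?thesis .
qed

text \<open>The difference is an integral over |x - y| between \<delta> and \<epsilon>; with the
  norm taken inside it becomes the increment of \<open>H\<close>.\<close>

lemma T_diff_le:
  assumes "0 < \<delta>" "\<delta> \<le> \<epsilon>"
  shows "norm (T \<delta> x - T \<epsilon> x) \<le> H \<delta> x - H \<epsilon> x"
proof -
  have \<epsilon>: "0 < \<epsilon>" using assms by simp
  have eq: "T \<delta> x - T \<epsilon> x = (\<integral>y. indicator {y. \<delta> < \<bar>x - y\<bar>} y *\<^sub>R (k x y * f y)
      - indicator {y. \<epsilon> < \<bar>x - y\<bar>} y *\<^sub>R (k x y * f y) \<partial>lebesgue)"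
    unfolding T_def set_lebesgue_integral_def
    by (rule Bochner_Integration.integral_diff[symmetric]) (intro integrable_section assms \<epsilon>)+
  have "norm (T \<delta> x - T \<epsilon> x) \<le> (\<integral>y. norm (indicator {y. \<delta> < \<bar>x - y\<bar>} y *\<^sub>R (k x y * f y)
      - indicator {y. \<epsilon> < \<bar>x - y\<bar>} y *\<^sub>R (k x y * f y)) \<partial>lebesgue)"
    unfolding eq by (rule integral_norm_bound)
  also have "\<dots> = (\<integral>y. indicator {y. \<delta> < \<bar>x - y\<bar>} y *\<^sub>R norm (k x y * f y)
      - indicator {y. \<epsilon> < \<bar>x - y\<bar>} y *\<^sub>R norm (k x y * f y) \<partial>lebesgue)"
  proof (rule Bochner_Integration.integral_cong[OF refl])
    fix y
    have "indicator {y. \<epsilon> < \<bar>x - y\<bar>} y \<le> (indicator {y. \<delta> < \<bar>x - y\<bar>} y :: real)"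
    proof (cases "\<epsilon> < \<bar>x - y\<bar>")
      case True
      with assms(2) have "\<delta> < \<bar>x - y\<bar>" by (rule le_less_trans)
      then show ?thesis by (simp add: indicator_def)
    qed simp
    then show "norm (indicator {y. \<delta> < \<bar>x - y\<bar>} y *\<^sub>R (k x y * f y) - indicator {y. \<epsilon> < \<bar>x - y\<bar>} y *\<^sub>R (k x y * f y))
      = indicator {y. \<delta> < \<bar>x - y\<bar>} y *\<^sub>R norm (k x y * f y) - indicator {y. \<epsilon> < \<bar>x - y\<bar>} y *\<^sub>R norm (k x y * f y)"
      by (simp only: scaleR_left_diff_distrib[symmetric] norm_scaleR real_scaleR_def abs_of_nonneg
          diff_ge_0_iff_ge left_diff_distrib[symmetric])
  qed
  also have "\<dots> = H \<delta> x - H \<epsilon> x"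
    unfolding H_def set_lebesgue_integral_def
    by (rule Bochner_Integration.integral_diff) (intro integrable_norm_section assms \<epsilon>)+
  finally show ?thesis .
qed

text \<open>Dominated convergence: the majorant has to be one fixed truncation, so parameters are
  first kept above a fixed \<open>c > 0\<close>.\<close>

lemma continuous_T: "continuous_on {0<..} (\<lambda>\<epsilon>. T \<epsilon> x)"
proof -
  have "continuous_on {c<..} (\<lambda>\<epsilon>. T \<epsilon> x)" if c: "0 < c" for c
  proof (rule continuous_on_sequentiallyI)
    fix e :: "nat \<Rightarrow> real" and \<epsilon> assume e: "\<forall>n. e n \<in> {c<..}" "\<epsilon> \<in> {c<..}" "e \<longlonglongrightarrow> \<epsilon>"
    show "(\<lambda>n. T (e n) x) \<longlonglongrightarrow> T \<epsilon> x"
      unfolding T_def set_lebesgue_integral_def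
    proof (rule integral_dominated_convergence[where w = "\<lambda>y. indicator {y. c < \<bar>x - y\<bar>} y *\<^sub>R norm (k x y * f y)"])
      show "AE y in lebesgue. (\<lambda>n. indicator {y. e n < \<bar>x - y\<bar>} y *\<^sub>R (k x y * f y))
          \<longlonglongrightarrow> indicator {y. \<epsilon> < \<bar>x - y\<bar>} y *\<^sub>R (k x y * f y)"
      proof -
        \<comment> \<open>The indicators converge except possibly at the two points at distance
          exactly \<epsilon> from \<open>x\<close>.\<close>
        have "AE y in lebesgue. y \<notin> {x - \<epsilon>, x + \<epsilon>}"
          by (intro AE_not_in null_sets_completionI finite_imp_null_set_lborel) auto
        then show ?thesis
        proof eventually_elim
          case (elim y)
          then have "\<bar>x - y\<bar> \<noteq> \<epsilon>" by (auto simp: abs_if split: if_splits)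
          then consider "\<epsilon> < \<bar>x - y\<bar>" | "\<bar>x - y\<bar> < \<epsilon>" by (metis linorder_neqE)
          then have "\<forall>\<^sub>F n in sequentially. indicator {y. \<epsilon> < \<bar>x - y\<bar>} y *\<^sub>R (k x y * f y)
              = indicator {y. e n < \<bar>x - y\<bar>} y *\<^sub>R (k x y * f y)"
          proof cases
            case 1
            from order_tendstoD(2)[OF e(3) 1] show ?thesis
              by eventually_elim (use 1 in auto)
          next
            case 2
            from order_tendstoD(1)[OF e(3) 2] show ?thesis
              by eventually_elim (use 2 in auto)
          qed
          then show ?case by (rule Lim_transform_eventually[OF tendsto_const])
        qed
      qed
      show "AE y in lebesgue. norm (indicator {y. e n < \<bar>x - y\<bar>} y *\<^sub>R (k x y * f y))
          \<le> indicator {y. c < \<bar>x - y\<bar>} y *\<^sub>R norm (k x y * f y)" for n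
        using e(1)[rule_format, of n] by (intro AE_I2) (auto split: split_indicator)
      show "integrable lebesgue (\<lambda>y. indicator {y. c < \<bar>x - y\<bar>} y *\<^sub>R norm (k x y * f y))"
        by (rule integrable_norm_section[OF c])
      show "(\<lambda>y. indicator {y. \<epsilon> < \<bar>x - y\<bar>} y *\<^sub>R (k x y * f y)) \<in> borel_measurable lebesgue"
        using c e(2) by (intro measurable_section) simp
      show "(\<lambda>y. indicator {y. e n < \<bar>x - y\<bar>} y *\<^sub>R (k x y * f y)) \<in> borel_measurable lebesgue" for n
        using c e(1)[rule_format, of n] by (intro measurable_section) simp
    qed
  qed
  \<comment> \<open>Continuity at \<open>c\<close> is read off from the open half-line above
    \<open>c / 2\<close>.\<close>
  then have "isCont (\<lambda>\<epsilon>. T \<epsilon> x) c" if "0 < c" for c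
    using that continuous_on_eq_continuous_at[OF open_greaterThan, of "c / 2" "\<lambda>\<epsilon>. T \<epsilon> x"] by auto
  then show ?thesis by (intro continuous_at_imp_continuous_on) auto
qed

end

section \<open>Domination of oscillation and variation by the fractional integral\<close>

theorem theorem1:
  fixes K :: "real \<Rightarrow> real \<Rightarrow> complex" and b :: "real \<Rightarrow> complex"
    and w :: "real \<Rightarrow> real" and t :: "nat \<Rightarrow> real" and m :: nat
    and C\<^sub>K \<delta> \<rho> \<beta> p\<^sub>0 p q \<kappa> :: real
  assumes "continuous_on {(x, y). x \<noteq> y} (\<lambda>(x, y). K x y)"
    and "C\<^sub>K > 0" and "0 < \<delta>" and "\<delta> < 1"
    and "\<And>x y. x \<noteq> y \<Longrightarrow> norm (K x y) \<le> C\<^sub>K / \<bar>x - y\<bar>"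
    and "\<And>x x0 y. \<bar>x - y\<bar> > 2 * \<bar>x - x0\<bar> \<Longrightarrow>
           norm (K x y - K x0 y) + norm (K y x - K y x0)
             \<le> C\<^sub>K / \<bar>x - y\<bar> * (\<bar>x - x0\<bar> / \<bar>x - y\<bar>) powr \<delta>"
    and "\<rho> > 2" and "m > 0" and "0 < \<beta>" and "\<beta> < 1"
    and "times_differentiable m b" and "nderiv m b \<in> lipschitz_space \<beta>"
    and "decseq t" and "\<And>i. t i > 0" and "t \<longlonglongrightarrow> 0"
    and "1 < p\<^sub>0"
    and "bounded_operator (oscillation t (sing_int K))
           (Lp_space p\<^sub>0) (Lp_norm p\<^sub>0) (Lp_space p\<^sub>0) (Lp_norm p\<^sub>0)"
    and "bounded_operator (variation \<rho> (sing_int K))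
           (Lp_space p\<^sub>0) (Lp_norm p\<^sub>0) (Lp_space p\<^sub>0) (Lp_norm p\<^sub>0)"
    and "1 < p" and "p < 1 / \<beta>" and "1 / q = 1 / p - \<beta>"
    and "0 < \<kappa>" and "\<kappa> < p / q" and "A_weight p q w"
  shows "bounded_operator (oscillation t (sing_comm m b K))
           (morrey_space p \<kappa> (\<lambda>x. w x powr p) (\<lambda>x. w x powr q))
           (morrey_norm p \<kappa> (\<lambda>x. w x powr p) (\<lambda>x. w x powr q))
           (morrey_space q (\<kappa> * q / p) (\<lambda>x. w x powr q) (\<lambda>x. w x powr q))
           (morrey_norm q (\<kappa> * q / p) (\<lambda>x. w x powr q) (\<lambda>x. w x powr q))
       \<and> bounded_operator (variation \<rho> (sing_comm m b K))
           (morrey_space p \<kappa> (\<lambda>x. w x powr p) (\<lambda>x. w x powr q))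
           (morrey_norm p \<kappa> (\<lambda>x. w x powr p) (\<lambda>x. w x powr q))
           (morrey_space q (\<kappa> * q / p) (\<lambda>x. w x powr q) (\<lambda>x. w x powr q))
           (morrey_norm q (\<kappa> * q / p) (\<lambda>x. w x powr q) (\<lambda>x. w x powr q))"
proof -
  obtain A u s where W: "Apq_weight p q \<beta> A w u s"
    using A_weight_Apq_weight[OF \<open>A_weight p q w\<close> \<open>1 < p\<close> \<open>0 < \<beta>\<close> \<open>p < 1 / \<beta>\<close> \<open>1 / q = 1 / p - \<beta>\<close>] .
  obtain L where L: "0 < L" "\<And>x y. norm (nderiv m b x - nderiv m b y) \<le> L * \<bar>x - y\<bar> powr \<beta>"
    using lipschitz_space_bound[OF \<open>nderiv m b \<in> lipschitz_space \<beta>\<close>] by blast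
  define k where "k x y = taylor_rem m b x y / complex_of_real (\<bar>x - y\<bar> ^ m) * K x y" for x y
  define C where "C = L * C\<^sub>K"
  have C: "0 < C" using L \<open>C\<^sub>K > 0\<close> by (simp add: C_def)
  \<comment> \<open>The Taylor bound |x - y|^(m+\<beta>) divided by |x - y|^m leaves |x -
    y|^\<beta>, and the size condition on \<open>K\<close> lowers the exponent by 1.\<close>
  have k_le: "norm (k x y) \<le> C * \<bar>x - y\<bar> powr (\<beta> - 1)" for x y
  proof (cases "x = y")
    case True
    \<comment> \<open>On the diagonal both sides are 0: \<open>0 ^ m = 0\<close> as
      \<open>m > 0\<close>, division by 0 yields 0, and \<open>0 powr _ = 0\<close>.\<close>
    then show ?thesis using \<open>m > 0\<close> by (simp add: k_def)
  next
    case False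
    have "norm (k x y) = norm (taylor_rem m b x y) / \<bar>x - y\<bar> ^ m * norm (K x y)"
      by (simp add: k_def norm_mult norm_divide norm_power)
    also have "\<dots> \<le> (L * \<bar>x - y\<bar> powr \<beta>) * (C\<^sub>K / \<bar>x - y\<bar>)"
    proof (intro mult_mono)
      show "norm (taylor_rem m b x y) / \<bar>x - y\<bar> ^ m \<le> L * \<bar>x - y\<bar> powr \<beta>"
        using taylor_rem_bound[OF \<open>times_differentiable m b\<close> less_imp_le[OF L(1)] \<open>0 < \<beta>\<close> L(2), of x y] False
        by (simp add: pos_divide_le_eq)
      show "norm (K x y) \<le> C\<^sub>K / \<bar>x - y\<bar>" by (rule assms(5)[OF False])
    qed (use L in auto)
    also have "\<dots> = C * \<bar>x - y\<bar> powr (\<beta> - 1)"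
      using False by (simp add: C_def powr_diff)
    finally show ?thesis .
  qed
  have k_meas: "(\<lambda>z. indicator {z. \<epsilon> < \<bar>fst z - snd z\<bar>} z *\<^sub>R k (fst z) (snd z)) \<in> borel_measurable (borel \<Otimes>\<^sub>M borel)"
    if "0 < \<epsilon>" for \<epsilon>
  proof -
    note [measurable] = measurable_kernel[OF assms(1) that]
      measurable_taylor_rem[OF nderiv_continuous[OF \<open>times_differentiable m b\<close> \<open>nderiv m b \<in> lipschitz_space \<beta>\<close> \<open>0 < \<beta>\<close>]]
    have "(\<lambda>z. taylor_rem m b (fst z) (snd z) / complex_of_real (\<bar>fst z - snd z\<bar> ^ m) *
        (indicator {z. \<epsilon> < \<bar>fst z - snd z\<bar>} z *\<^sub>R K (fst z) (snd z))) \<in> borel_measurable (borel \<Otimes>\<^sub>M borel)"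
      by measurable
    then show ?thesis by (simp add: k_def)
  qed
  have trunc: "truncated_kernel k f"
    and H_le: "0 < \<epsilon> \<Longrightarrow> ennreal (truncated_kernel.H k f \<epsilon> x) \<le> ennreal C * frac_int \<beta> (\<lambda>y. norm (f y)) x"
    if f [measurable]: "f \<in> borel_measurable lebesgue" and M: "Apq_morrey p q \<beta> A w u s \<kappa> F (\<lambda>y. norm (f y))"
    for f :: "real \<Rightarrow> complex" and F \<epsilon> x
  proof -
    interpret M: Apq_morrey p q \<beta> A w u s \<kappa> F "\<lambda>y. norm (f y)" by (rule M)
    have le: "(\<integral>\<^sup>+y. ennreal (norm (k x y * f y)) * indicator {y. \<epsilon> < \<bar>x - y\<bar>} y \<partial>lebesgue)
      \<le> ennreal C * (\<integral>\<^sup>+y. ennreal (\<bar>x - y\<bar> powr (\<beta> - 1) * norm (f y)) * indicator {y. \<epsilon> < \<bar>x - y\<bar>} y \<partial>lebesgue)"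
      for \<epsilon> x
    proof -
      have "(\<integral>\<^sup>+y. ennreal (norm (k x y * f y)) * indicator {y. \<epsilon> < \<bar>x - y\<bar>} y \<partial>lebesgue)
        \<le> (\<integral>\<^sup>+y. ennreal C * (ennreal (\<bar>x - y\<bar> powr (\<beta> - 1) * norm (f y)) * indicator {y. \<epsilon> < \<bar>x - y\<bar>} y) \<partial>lebesgue)"
      proof (intro nn_integral_mono)
        fix y
        have "norm (k x y * f y) \<le> C * (\<bar>x - y\<bar> powr (\<beta> - 1) * norm (f y))"
          using mult_right_mono[OF k_le[of x y], of "norm (f y)"] by (simp add: norm_mult mult.assoc)
        then show "ennreal (norm (k x y * f y)) * indicator {y. \<epsilon> < \<bar>x - y\<bar>} y
            \<le> ennreal C * (ennreal (\<bar>x - y\<bar> powr (\<beta> - 1) * norm (f y)) * indicator {y. \<epsilon> < \<bar>x - y\<bar>} y)"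
          using C by (auto simp: ennreal_leI simp flip: ennreal_mult split: split_indicator)
      qed
      also have "\<dots> = ennreal C * (\<integral>\<^sup>+y. ennreal (\<bar>x - y\<bar> powr (\<beta> - 1) * norm (f y)) * indicator {y. \<epsilon> < \<bar>x - y\<bar>} y \<partial>lebesgue)"
        by (rule nn_integral_cmult) measurable
      finally show ?thesis .
    qed
    show tk: "truncated_kernel k f"
    proof
      fix \<epsilon> x :: real assume \<epsilon>: "0 < \<epsilon>"
      have "(\<integral>\<^sup>+y. ennreal (\<bar>x - y\<bar> powr (\<beta> - 1) * norm (f y)) * indicator {y. \<epsilon> < \<bar>x - y\<bar>} y \<partial>lebesgue) < \<infinity>"
        \<comment> \<open>The estimate for large scales on the interval from \<open>x\<close> to
          \<open>x + \<epsilon>\<close>, evaluated at its left end, is exactly finiteness of the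
          tail.\<close>
        using M.outer_le[of x x "x + \<epsilon>"] \<epsilon> by (auto simp: less_top[symmetric] top_unique)
      then have "ennreal C * (\<integral>\<^sup>+y. ennreal (\<bar>x - y\<bar> powr (\<beta> - 1) * norm (f y)) * indicator {y. \<epsilon> < \<bar>x - y\<bar>} y \<partial>lebesgue) < \<infinity>"
        by (simp add: ennreal_mult_less_top)
      then show "(\<integral>\<^sup>+y. ennreal (norm (k x y * f y)) * indicator {y. \<epsilon> < \<bar>x - y\<bar>} y \<partial>lebesgue) < \<infinity>"
        by (rule le_less_trans[OF le])
    qed (use k_meas in auto)
    assume \<epsilon>: "0 < \<epsilon>"
    have "ennreal (truncated_kernel.H k f \<epsilon> x)
      \<le> ennreal C * (\<integral>\<^sup>+y. ennreal (\<bar>x - y\<bar> powr (\<beta> - 1) * norm (f y)) * indicator {y. \<epsilon> < \<bar>x - y\<bar>} y \<partial>lebesgue)"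
      unfolding truncated_kernel.H_eq[OF tk \<epsilon>] by (rule le)
    also have "\<dots> \<le> ennreal C * frac_int \<beta> (\<lambda>y. norm (f y)) x"
      unfolding frac_int_def by (intro mult_left_mono nn_integral_mono) (auto split: split_indicator)
    finally show "ennreal (truncated_kernel.H k f \<epsilon> x) \<le> ennreal C * frac_int \<beta> (\<lambda>y. norm (f y)) x" .
  qed
  have T: "sing_comm m b K \<epsilon> f x = truncated_kernel.T k f \<epsilon> x"
    if "truncated_kernel k f" for \<epsilon> f x
    unfolding truncated_kernel.T_def[OF that] sing_comm_def k_def ..
  have S: "sing_comm m b K \<epsilon> f = truncated_kernel.T k f \<epsilon>" if "truncated_kernel k f" for \<epsilon> f
    using T[OF that] by blast
  show ?thesis
  \<comment> \<open>After the transfer to Morrey norms, measurability and the pointwise bound by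
    \<open>frac_int\<close> remain for each of the two operators.\<close>
  proof (intro conjI bounded_operator_of_frac_int[OF W \<open>0 < \<kappa>\<close> \<open>\<kappa> < p / q\<close> less_imp_le[OF C]] allI)
    fix f :: "real \<Rightarrow> complex" and F x
    assume f: "f \<in> borel_measurable lebesgue" and M: "Apq_morrey p q \<beta> A w u s \<kappa> F (\<lambda>y. norm (f y))"
    note tk = trunc[OF f M]
    show "oscillation t (sing_comm m b K) f \<in> borel_measurable lebesgue"
      by (intro measurable_oscillation)
        (use assms(14) truncated_kernel.measurable_T[OF tk] truncated_kernel.continuous_T[OF tk] in \<open>auto simp: S[OF tk]\<close>)
    show "variation \<rho> (sing_comm m b K) f \<in> borel_measurable lebesgue"
      by (intro measurable_variation)
        (use \<open>\<rho> > 2\<close> truncated_kernel.measurable_T[OF tk] truncated_kernel.continuous_T[OF tk] in \<open>auto simp: S[OF tk]\<close>)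
    show "oscillation t (sing_comm m b K) f x \<le> ennreal C * frac_int \<beta> (\<lambda>y. norm (f y)) x"
      by (rule oscillation_le[where H = "\<lambda>\<epsilon>. truncated_kernel.H k f \<epsilon> x"])
        (use assms(13,14) truncated_kernel.H_nonneg[OF tk] H_le[OF f M] truncated_kernel.T_diff_le[OF tk] in \<open>auto simp: T[OF tk]\<close>)
    show "variation \<rho> (sing_comm m b K) f x \<le> ennreal C * frac_int \<beta> (\<lambda>y. norm (f y)) x"
      by (rule variation_le[where H = "\<lambda>\<epsilon>. truncated_kernel.H k f \<epsilon> x"])
        (use \<open>\<rho> > 2\<close> truncated_kernel.H_nonneg[OF tk] H_le[OF f M] truncated_kernel.T_diff_le[OF tk] in \<open>auto simp: T[OF tk]\<close>)
  qed
qed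

end
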